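(* Let $(\alpha,\beta)\in[0,2\pi)^2$, $s=\sin(\alpha+\beta)$, $r=\sin(\alpha-\beta)$. The dispersion relation for edge states (that is, $k\mapsto\theta_0(k)$, defined when $s\neq0$, for $k\notin\{\pi/2,3\pi/2\}$) is monotonic on $\mathbb{T}=\mathbb{R}/(2\pi\mathbb{Z})$, with $Ed\cap Bu=\emptyset$, and is discontinuous only at $k=\pi/2$ and $k=3\pi/2$ (mod $2\pi$) on $\mathbb{T}$. At these points there is a jump, that is, for $k_*=\pi/2$ and $k_*=3\pi/2$, $$\lim_{k\uparrow k_*}\theta_0(k)\neq\lim_{k\downarrow k_*}\theta_0(k),$$ and the points $\big(k_*,\lim_{k\uparrow k_*}\theta_0(k)\big)$ and $\big(k_*,\lim_{k\downarrow k_*}\theta_0(k)\big)$ belong to $Bu$. More precisely, divide the parameter space $[0,2\pi)^2$ into six classes according to the pair of signs $(\operatorname{sgn}(s),\operatorname{sgn}(r))$: (1) $(0,0)$ and $(0,\pm)$ classes: this is the condition for vanishing gaps in the bulk spectrum at $k=0$ and $k=\pi$. There are no edge states for all $k\in[0,2\pi)$, that is, $\theta_0(k)$ cannot be defined. (2) $(+,+)$ class: the dispersion relation for edge states monotonically increases on $\mathbb{T}$. The discontinuity at $k=\pi/2$ occurs between $(\pi/2,\pi+\theta_c(\pi/2))$ and $(\pi/2,2\pi-\theta_c(\pi/2))$, and the one at $k=3\pi/2$ occurs between $(3\pi/2,\theta_c(3\pi/2))$ and $(3\pi/2,\pi-\theta_c(3\pi/2))$. (3) $(+,-)$ class: the dispersion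 relation for edge states monotonically decreases on $\mathbb{T}$. The discontinuity at $k=\pi/2$ occurs between $(\pi/2,\theta_c(\pi/2))$ and $(\pi/2,\pi-\theta_c(\pi/2))$, and that at $k=3\pi/2$ occurs between $(3\pi/2,\pi+\theta_c(3\pi/2))$ and $(3\pi/2,2\pi-\theta_c(3\pi/2))$. (4) $(-,+)$ class: the dispersion relation for edge states monotonically decreases on $\mathbb{T}$. The discontinuity at $k=\pi/2$ occurs between $(\pi/2,\pi+\theta_c(\pi/2))$ and $(\pi/2,2\pi-\theta_c(\pi/2))$, and that at $k=3\pi/2$ occurs between $(3\pi/2,\theta_c(3\pi/2))$ and $(3\pi/2,\pi-\theta_c(3\pi/2))$. (5) $(-,-)$ class: the dispersion relation for edge states monotonically increases on $\mathbb{T}$. The discontinuity at $k=\pi/2$ occurs between $(\pi/2,\theta_c(\pi/2))$ and $(\pi/2,\pi-\theta_c(\pi/2))$, and that at $k=3\pi/2$ occurs between $(3\pi/2,\pi+\theta_c(3\pi/2))$ and $(3\pi/2,2\pi-\theta_c(3\pi/2))$. (6) $(\pm,0)$ class: this is the condition for vanishing gaps in the bulk spectrum at $k=\pi/2$ and $k=3\pi/2$. The group velocity $d\theta_0/dk$ is zero, that is, the quasi-energy $\theta_0(k)$ of the edge states has no wave number dependence.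
   Context: For $k\in[0,2\pi)$ let $\eta(k)=-\cos k\,\sin(\alpha+\beta)+i\sin k\,\sin(\alpha-\beta)$, $\rho(k)=\sqrt{1-|\eta(k)|^2}=\sqrt{\cos^2(\alpha-\beta)-\sin2\alpha\sin2\beta\cos^2k}$, $\theta_c(k)=\arccos(\rho(k))$, and $$\theta_0(k)=\begin{cases}\arcsin(-\sin k\,\sin(\alpha-\beta))&\text{if }\cos k\,\sin(\alpha+\beta)\le0,\\ \pi-\arcsin(-\sin k\,\sin(\alpha-\beta))&\text{if }\cos k\,\sin(\alpha+\beta)>0,\end{cases}$$ with angles $\theta$ taken modulo $2\pi$. $\mathcal{C}_k$ is the CMV matrix with Verblunsky parameters $(\eta(k),0,\eta(k),0,\dots)$, i.e. the matrix acting on $\ell^2(\{0,1,2,\dots\})$ with (writing $\eta=\eta(k)$, $\rho=\rho(k)$) $\mathcal{C}_{0,0}=\overline\eta$, $\mathcal{C}_{0,2}=\rho$, $\mathcal{C}_{1,0}=\rho$, $\mathcal{C}_{1,2}=-\eta$, and for $j\ge1$: $\mathcal{C}_{2j,2j-1}=\overline\eta$, $\mathcal{C}_{2j,2j+2}=\rho$, $\mathcal{C}_{2j+1,2j-1}=\rho$, $\mathcal{C}_{2j+1,2j+2}=-\eta$, all other entries $0$. With $\sigma_c^{(k)}$ and $\sigma_p^{(k)}$ its continuous and point spectra, $$Bu=\bigcup_{k\in[0,2\pi)}\{(k,\theta):e^{i\theta}\in\sigma_c^{(k)}\},\qquad Ed=\bigcup_{k\in[0,2\pi)}\{(k,\theta):e^{i\theta}\in\sigma_p^{(k)}\}$$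 are the dispersion relations for bulk and edge states. The bulk spectrum at $k$ is $[\theta_c(k),\pi-\theta_c(k)]\cup[\pi+\theta_c(k),2\pi-\theta_c(k)]$; its gaps vanish at $k$ when $\theta_c(k)=0$.
   Formalization: The absence of edge states in class (1), the jump and membership of its endpoints in Bu, and Ed being the graph of θ_0 are claimed only at k with |η(k)|<1; where |η(k)|=1 (e.g. |r|=1, k=π/2) they fail: the limits coincide, σ_c is empty, extra eigenvalues ±i occur. *)

theory Defs
  imports "HOL-Analysis.Analysis"
begin

definition ell2 :: "(nat \<Rightarrow> complex) set" where
  "ell2 = {u. summable (\<lambda>n. (cmod (u n))\<^sup>2)}"

definition ell2_inner :: "(nat \<Rightarrow> complex) \<Rightarrow> (nat \<Rightarrow> complex) \<Rightarrow> complex" where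
  "ell2_inner v u = (\<Sum>n. cnj (v n) * u n)"

definition mat_op :: "(nat \<Rightarrow> nat \<Rightarrow> complex) \<Rightarrow> (nat \<Rightarrow> complex) \<Rightarrow> nat \<Rightarrow> complex" where
  "mat_op A u = (\<lambda>i. \<Sum>j. A i j * u j)"

definition eigenvector :: "(nat \<Rightarrow> nat \<Rightarrow> complex) \<Rightarrow> complex \<Rightarrow> (nat \<Rightarrow> complex) \<Rightarrow> bool" where
  "eigenvector A z v \<longleftrightarrow> v \<in> ell2 \<and> v \<noteq> (\<lambda>_. 0) \<and> mat_op A v = (\<lambda>n. z * v n)"

definition point_spectrum :: "(nat \<Rightarrow> nat \<Rightarrow> complex) \<Rightarrow> complex set" where
  "point_spectrum A = {z. \<exists>v. eigenvector A z v}"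

text \<open>For a normal operator, the orthogonal complement of all eigenvectors reduces the operator
  (it is the subspace of vectors with atomless spectral measure). The continuous spectrum is the
  spectrum of the restriction to it, so that it is not disjoint from the point spectrum by mere
  definition. By the bounded inverse theorem, invertibility of a bounded operator on this
  closed subspace amounts to bijectivity.\<close>

definition cont_subspace :: "(nat \<Rightarrow> nat \<Rightarrow> complex) \<Rightarrow> (nat \<Rightarrow> complex) set" where
  "cont_subspace A = {u \<in> ell2. \<forall>z v. eigenvector A z v \<longrightarrow> ell2_inner v u = 0}"

definition cont_spectrum :: "(nat \<Rightarrow> nat \<Rightarrow> complex) \<Rightarrow> complex set" where
  "cont_spectrum A =
     {z. \<not> bij_betw (\<lambda>u n. mat_op A u n - z * u n) (cont_subspace A) (cont_subspace A)}"

definition eta :: "real \<Rightarrow> real \<Rightarrow> real \<Rightarrow> complex" where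
  "eta \<alpha> \<beta> k = Complex (- cos k * sin (\<alpha> + \<beta>)) (sin k * sin (\<alpha> - \<beta>))"

definition rho :: "real \<Rightarrow> real \<Rightarrow> real \<Rightarrow> real" where
  "rho \<alpha> \<beta> k = sqrt (1 - (cmod (eta \<alpha> \<beta> k))\<^sup>2)"

definition theta_c :: "real \<Rightarrow> real \<Rightarrow> real \<Rightarrow> real" where
  "theta_c \<alpha> \<beta> k = arccos (rho \<alpha> \<beta> k)"

text \<open>The formula is \<open>2 * pi\<close>-periodic in \<open>k\<close>, so evaluating it at every real \<open>k\<close> represents a
  function on the circle. It is meaningful for \<open>sin (\<alpha> + \<beta>) \<noteq> 0\<close> and \<open>cos k \<noteq> 0\<close> only.\<close>

definition theta0 :: "real \<Rightarrow> real \<Rightarrow> real \<Rightarrow> real" where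
  "theta0 \<alpha> \<beta> k =
     (if cos k * sin (\<alpha> + \<beta>) \<le> 0 then arcsin (- sin k * sin (\<alpha> - \<beta>))
      else pi - arcsin (- sin k * sin (\<alpha> - \<beta>)))"

text \<open>CMV matrix with Verblunsky parameters \<open>(\<eta>, 0, \<eta>, 0, \<dots>)\<close>. Rows \<open>0\<close> and \<open>1\<close> rely on truncated
  subtraction: there, \<open>i - 1\<close> and \<open>i - 2\<close>, respectively, denote column \<open>0\<close>.\<close>

definition cmv :: "real \<Rightarrow> real \<Rightarrow> real \<Rightarrow> nat \<Rightarrow> nat \<Rightarrow> complex" where
  "cmv \<alpha> \<beta> k i j =
     (if even i then
        (if j = i - 1 then cnj (eta \<alpha> \<beta> k)
         else if j = i + 2 then complex_of_real (rho \<alpha> \<beta> k) else 0)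
      else
        (if j = i - 2 then complex_of_real (rho \<alpha> \<beta> k)
         else if j = i + 1 then - eta \<alpha> \<beta> k else 0))"

text \<open>Angles modulo \<open>2 * pi\<close>: both sets contain every real representative of \<open>\<theta>\<close>.\<close>

definition Bu :: "real \<Rightarrow> real \<Rightarrow> (real \<times> real) set" where
  "Bu \<alpha> \<beta> = (\<Union>k\<in>{0..<2 * pi}. {(k, \<theta>) | \<theta>. cis \<theta> \<in> cont_spectrum (cmv \<alpha> \<beta> k)})"

definition Ed :: "real \<Rightarrow> real \<Rightarrow> (real \<times> real) set" where
  "Ed \<alpha> \<beta> = (\<Union>k\<in>{0..<2 * pi}. {(k, \<theta>) | \<theta>. cis \<theta> \<in> point_spectrum (cmv \<alpha> \<beta> k)})"

text \<open>The two components of the circle \<open>\<real> / 2\<pi>\<int>\<close> with \<open>\<pi>/2\<close> and \<open>3\<pi>/2\<close> removed; on each of them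
  \<open>theta0\<close> is a continuous real-valued lift, so monotonicity modulo \<open>2 * pi\<close> is that of the
  real values.\<close>

definition arcs :: "real set set" where
  "arcs = {{- pi / 2<..<pi / 2}, {pi / 2<..<3 * pi / 2}}"

definition increasing_on_circle :: "(real \<Rightarrow> real) \<Rightarrow> bool" where
  "increasing_on_circle f \<longleftrightarrow> (\<forall>I\<in>arcs. strict_mono_on I f)"

definition decreasing_on_circle :: "(real \<Rightarrow> real) \<Rightarrow> bool" where
  "decreasing_on_circle f \<longleftrightarrow> (\<forall>I\<in>arcs. strict_antimono_on I f)"

definition monotonic_on_circle :: "(real \<Rightarrow> real) \<Rightarrow> bool" where
  "monotonic_on_circle f \<longleftrightarrow> (\<forall>I\<in>arcs. mono_on I f) \<or> (\<forall>I\<in>arcs. antimono_on I f)"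

text \<open>One-sided limits of an angle-valued function, modulo \<open>2 * pi\<close>.\<close>

definition left_limit :: "(real \<Rightarrow> real) \<Rightarrow> real \<Rightarrow> real \<Rightarrow> bool" where
  "left_limit f k l \<longleftrightarrow> ((\<lambda>x. cis (f x)) \<longlongrightarrow> cis l) (at_left k)"

definition right_limit :: "(real \<Rightarrow> real) \<Rightarrow> real \<Rightarrow> real \<Rightarrow> bool" where
  "right_limit f k l \<longleftrightarrow> ((\<lambda>x. cis (f x)) \<longlongrightarrow> cis l) (at_right k)"

text \<open>Which of the two angles is the left and which the right limit is left open.\<close>

definition jumps_between :: "(real \<Rightarrow> real) \<Rightarrow> real \<Rightarrow> real \<Rightarrow> real \<Rightarrow> bool" where
  "jumps_between f k a b \<longleftrightarrow>
     (left_limit f k a \<and> right_limit f k b) \<or> (left_limit f k b \<and> right_limit f k a)"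

end

theory Submission
  imports Defs
begin

text \<open>Write \<open>a j = u (2 j - 1)\<close> and \<open>b j = u (2 j)\<close>. The equation \<open>C u - z u = f\<close> is a first-order
  recurrence for \<open>(a, b)\<close> whose transfer matrix has determinant 1, started on the line \<open>a 0 = b 0\<close>.
  A square-summable homogeneous solution has vanishing determinant of consecutive values, so
  \<open>(1, 1)\<close> must be an eigenvector of the transfer matrix. This forces
  \<open>z = x - i Im \<eta>\<close> with \<open>x\<^sup>2 = 1 - (Im \<eta>)\<^sup>2\<close>, and \<open>z\<close> is an eigenvalue iff
  \<open>l = (x - Re \<eta>) / \<rho>\<close> satisfies \<open>\<bar>l\<bar> < 1\<close>; this selects the branch of \<open>theta0\<close>.
  For such \<open>z\<close> the recurrence is triangular in \<open>(b, a - b)\<close> with diagonal \<open>l, 1 / l\<close>. If \<open>\<bar>l\<bar> < 1\<close>, solving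
  for \<open>a - b\<close> backwards and for \<open>b\<close> forwards inverts \<open>C - z\<close> on the complement of the eigenvector,
  so \<open>z\<close> is not in the continuous spectrum. If \<open>Re \<eta> = 0\<close>, then \<open>\<bar>l\<bar> = 1\<close>, there is no eigenvector at all,
  and the first unit vector is not in the range of \<open>C - z\<close>.\<close>

subsection \<open>Square-summable sequences\<close>

lemma ell2_iff_bounded_partial_sums:
  "u \<in> ell2 \<longleftrightarrow> (\<exists>B. \<forall>n. (\<Sum>i<n. (cmod (u i))\<^sup>2) \<le> B)"
proof
  assume "u \<in> ell2"
  then have "(\<Sum>i<n. (cmod (u i))\<^sup>2) \<le> (\<Sum>i. (cmod (u i))\<^sup>2)" for n
    unfolding ell2_def by (intro sum_le_suminf) auto
  then show "\<exists>B. \<forall>n. (\<Sum>i<n. (cmod (u i))\<^sup>2) \<le> B"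
    by blast
next
  assume "\<exists>B. \<forall>n. (\<Sum>i<n. (cmod (u i))\<^sup>2) \<le> B"
  then obtain B where B: "\<And>n. (\<Sum>i<n. (cmod (u i))\<^sup>2) \<le> B" by blast
  show "u \<in> ell2"
    unfolding ell2_def mem_Collect_eq
    by (rule summableI_nonneg_bounded[where x = B]) (use B in auto)
qed

lemma ell2_scale: "u \<in> ell2 \<Longrightarrow> (\<lambda>n. c * u n) \<in> ell2"
  by (auto simp: ell2_def norm_mult power_mult_distrib intro: summable_mult)

lemma ell2_add:
  assumes "u \<in> ell2" and "v \<in> ell2"
  shows "(\<lambda>n. u n + v n) \<in> ell2"
proof -
  have "norm ((cmod (u n + v n))\<^sup>2) \<le> 2 * (cmod (u n))\<^sup>2 + 2 * (cmod (v n))\<^sup>2" for n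
  proof -
    have "(cmod (u n + v n))\<^sup>2 \<le> (cmod (u n) + cmod (v n))\<^sup>2"
      by (intro power_mono norm_triangle_ineq) auto
    also have "\<dots> \<le> 2 * (cmod (u n))\<^sup>2 + 2 * (cmod (v n))\<^sup>2"
      using sum_squares_bound[of "cmod (u n)" "cmod (v n)"] by (simp add: power2_sum)
    finally show ?thesis
      by simp
  qed
  moreover have "summable (\<lambda>n. 2 * (cmod (u n))\<^sup>2 + 2 * (cmod (v n))\<^sup>2)"
    using assms by (auto simp: ell2_def intro!: summable_add summable_mult)
  ultimately show ?thesis
    unfolding ell2_def mem_Collect_eq
    by (rule summable_comparison_test'[where N = 0, rotated])
qed

lemma ell2_diff: "u \<in> ell2 \<Longrightarrow> v \<in> ell2 \<Longrightarrow> (\<lambda>n. u n - v n) \<in> ell2"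
  using ell2_add[of u "\<lambda>n. (-1) * v n"] ell2_scale[of v "-1"] by simp

lemma ell2_reindex: "u \<in> ell2 \<Longrightarrow> inj g \<Longrightarrow> (\<lambda>n. u (g n)) \<in> ell2"
  using summable_reindex[of "\<lambda>n. (cmod (u n))\<^sup>2" g] by (simp add: ell2_def o_def)

text \<open>Membership is later checked separately on the two interleaved sequences in which the CMV
  equation is a recurrence.\<close>

lemma ell2_even_odd:
  assumes "(\<lambda>j. u (2 * j)) \<in> ell2" and "(\<lambda>j. u (2 * j + 1)) \<in> ell2"
  shows "u \<in> ell2"
proof -
  obtain x y where x: "(\<lambda>j. (cmod (u (2 * j)))\<^sup>2) sums x"
    and y: "(\<lambda>j. (cmod (u (2 * j + 1)))\<^sup>2) sums y"
    using assms unfolding ell2_def summable_def by blast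
  have "(\<lambda>n. if even n then (cmod (u (2 * (n div 2))))\<^sup>2
      else (cmod (u (2 * ((n - 1) div 2) + 1)))\<^sup>2) sums (y + x)"
    by (rule sums_if[OF y x])
  moreover have "(if even n then (cmod (u (2 * (n div 2))))\<^sup>2
      else (cmod (u (2 * ((n - 1) div 2) + 1)))\<^sup>2) = (cmod (u n))\<^sup>2" for n
    by (auto elim!: oddE)
  ultimately show ?thesis
    by (auto simp: ell2_def summable_def)
qed

lemma ell2_tendsto_0:
  assumes "u \<in> ell2"
  shows "u \<longlonglongrightarrow> 0"
proof -
  have "(\<lambda>n. (cmod (u n))\<^sup>2) \<longlonglongrightarrow> 0"
    using assms unfolding ell2_def by (intro summable_LIMSEQ_zero) simp
  from tendsto_real_sqrt[OF this] have "(\<lambda>n. cmod (u n)) \<longlonglongrightarrow> 0"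
    by simp
  then show ?thesis
    by (rule tendsto_norm_zero_cancel)
qed

section \<open>Inner product of square-summable sequences\<close>

lemma ell2_inner_summable:
  assumes "u \<in> ell2" and "v \<in> ell2"
  shows "summable (\<lambda>n. cnj (v n) * u n)"
proof (rule summable_comparison_test'[where N = 0])
  show "summable (\<lambda>n. (cmod (v n))\<^sup>2 + (cmod (u n))\<^sup>2)"
    using assms by (auto simp: ell2_def intro: summable_add)
  show "norm (cnj (v n) * u n) \<le> (cmod (v n))\<^sup>2 + (cmod (u n))\<^sup>2" for n
  proof -
    have "0 \<le> cmod (v n) * cmod (u n)"
      by simp
    then show ?thesis
      using sum_squares_bound[of "cmod (v n)" "cmod (u n)"]
      unfolding norm_mult complex_mod_cnj by linarith
  qed
qed

lemma ell2_inner_scale_left: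
  assumes "u \<in> ell2" and "v \<in> ell2"
  shows "ell2_inner (\<lambda>n. c * v n) u = cnj c * ell2_inner v u"
  unfolding ell2_inner_def
  using suminf_mult[OF ell2_inner_summable[OF assms], of "cnj c"] by (simp add: mult.assoc)

lemma ell2_inner_diff_scale_right:
  assumes "u \<in> ell2" and "w \<in> ell2" and "v \<in> ell2"
  shows "ell2_inner v (\<lambda>n. u n - c * w n) = ell2_inner v u - c * ell2_inner v w"
proof -
  have "ell2_inner v u - c * ell2_inner v w
      = (\<Sum>n. cnj (v n) * u n) - (\<Sum>n. c * (cnj (v n) * w n))"
    unfolding ell2_inner_def by (simp add: suminf_mult ell2_inner_summable assms)
  also have "\<dots> = (\<Sum>n. cnj (v n) * u n - c * (cnj (v n) * w n))"
    by (intro suminf_diff summable_mult ell2_inner_summable assms)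
  finally show ?thesis
    unfolding ell2_inner_def by (simp add: algebra_simps)
qed

lemma ell2_inner_self_eq_0:
  assumes "u \<in> ell2" and "ell2_inner u u = 0"
  shows "u = (\<lambda>_. 0)"
proof -
  have "(\<lambda>n. complex_of_real ((cmod (u n))\<^sup>2)) sums complex_of_real (\<Sum>n. (cmod (u n))\<^sup>2)"
    using assms(1) by (intro sums_of_real summable_sums) (simp add: ell2_def)
  then have "ell2_inner u u = complex_of_real (\<Sum>n. (cmod (u n))\<^sup>2)"
    unfolding ell2_inner_def
    by (simp add: sums_iff complex_norm_square mult.commute flip: of_real_power)
  then have "(\<Sum>n. (cmod (u n))\<^sup>2) = 0"
    using assms(2) by simp
  then show ?thesis
    using assms(1) suminf_eq_zero_iff[of "\<lambda>n. (cmod (u n))\<^sup>2"] by (auto simp: ell2_def)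
qed

text \<open>Rows \<open>2 j\<close> and \<open>2 j + 1\<close> make up one step of the recurrence,
  so inner products are grouped in the same blocks of two.\<close>

lemma ell2_inner_even_odd:
  assumes "u \<in> ell2" and "v \<in> ell2"
  shows "(\<lambda>j. cnj (v (2 * j)) * u (2 * j) + cnj (v (2 * j + 1)) * u (2 * j + 1))
    sums ell2_inner v u"
proof -
  have *: "{n * 2..<n * 2 + 2} = {2 * n, 2 * n + 1}" for n :: nat
    by auto
  have "(\<lambda>n. cnj (v n) * u n) sums ell2_inner v u"
    unfolding ell2_inner_def by (intro summable_sums ell2_inner_summable assms)
  from sums_group[OF this, of 2] show ?thesis
    by (simp add: * mult.commute[of _ 2])
qed

text \<open>Convexity of the square. Summed along a recurrence, it bounds the partial sums of squares in
  terms of themselves, with a factor \<open>q < 1\<close>.\<close>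

lemma contraction_square_bound:
  fixes q x g :: real
  assumes "0 \<le> q" and "q < 1"
  shows "(q * x + g)\<^sup>2 \<le> q * x\<^sup>2 + g\<^sup>2 / (1 - q)"
proof -
  have "(q * x\<^sup>2 + g\<^sup>2 / (1 - q) - (q * x + g)\<^sup>2) * (1 - q) = q * ((1 - q) * x - g)\<^sup>2"
    using assms by (simp add: field_simps power2_eq_square)
  also have "\<dots> \<ge> 0"
    using assms by simp
  finally show ?thesis
    using assms by (simp add: zero_le_mult_iff)
qed

text \<open>Summing the squared bound puts \<open>q\<close> times the partial sum itself on the
  right; absorbing it on the left leaves the factor \<open>1 - q\<close>. The starting value
  contributes only the constant \<open>(cmod (x 0))\<^sup>2\<close>.\<close>

lemma ell2_forward_recurrence:
  fixes l :: complex
  assumes "cmod l < 1" and "G \<in> ell2" and "\<And>j. x (Suc j) = l * x j + G j"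
  shows "x \<in> ell2"
proof -
  define q where "q = cmod l"
  define B where "B = (\<Sum>i. (cmod (G i))\<^sup>2)"
  have q: "0 \<le> q" "q < 1"
    using assms(1) by (auto simp: q_def)
  have GB: "(\<Sum>i<n. (cmod (G i))\<^sup>2) \<le> B" for n
    using assms(2) by (auto simp: ell2_def B_def intro!: sum_le_suminf)
  have step: "(cmod (x (Suc j)))\<^sup>2 \<le> q * (cmod (x j))\<^sup>2 + (cmod (G j))\<^sup>2 / (1 - q)" for j
  proof -
    have "cmod (x (Suc j)) \<le> q * cmod (x j) + cmod (G j)"
      unfolding assms(3) q_def by (metis norm_mult norm_triangle_ineq)
    then have "(cmod (x (Suc j)))\<^sup>2 \<le> (q * cmod (x j) + cmod (G j))\<^sup>2"
      by (intro power_mono) auto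
    with contraction_square_bound[OF q] show ?thesis
      by (meson order_trans)
  qed
  have "(\<Sum>i<n. (cmod (x i))\<^sup>2) \<le> ((cmod (x 0))\<^sup>2 + B / (1 - q)) / (1 - q)" for n
  proof -
    have "(\<Sum>i<n. (cmod (x i))\<^sup>2) \<le> (\<Sum>i<Suc n. (cmod (x i))\<^sup>2)"
      by simp
    also have "\<dots> = (cmod (x 0))\<^sup>2 + (\<Sum>i<n. (cmod (x (Suc i)))\<^sup>2)"
      by (rule sum.lessThan_Suc_shift)
    also have "(\<Sum>i<n. (cmod (x (Suc i)))\<^sup>2)
        \<le> (\<Sum>i<n. q * (cmod (x i))\<^sup>2 + (cmod (G i))\<^sup>2 / (1 - q))"
      by (intro sum_mono step)
    also have "\<dots> = q * (\<Sum>i<n. (cmod (x i))\<^sup>2) + (\<Sum>i<n. (cmod (G i))\<^sup>2) / (1 - q)"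
      by (simp add: sum.distrib sum_distrib_left sum_divide_distrib)
    also have "(\<Sum>i<n. (cmod (G i))\<^sup>2) / (1 - q) \<le> B / (1 - q)"
      using GB q by (intro divide_right_mono) auto
    finally have "(\<Sum>i<n. (cmod (x i))\<^sup>2) * (1 - q) \<le> (cmod (x 0))\<^sup>2 + B / (1 - q)"
      by (simp add: algebra_simps)
    then show ?thesis
      using q by (simp add: pos_le_divide_eq)
  qed
  then show ?thesis
    unfolding ell2_iff_bounded_partial_sums by blast
qed

text \<open>Here the recurrence runs towards smaller indices and there is no starting value. The
  bound \<open>M\<close> replaces it: shifting a partial sum by one index costs at most
  \<open>M\<^sup>2\<close>. It also excludes homogeneous solutions growing like
  \<open>l ^ (- j)\<close>.\<close>

lemma ell2_backward_recurrence:
  fixes l :: complex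
  assumes "cmod l < 1" and "G \<in> ell2" and "\<And>j. x j = l * x (Suc j) + G j"
    and M: "\<And>j. cmod (x j) \<le> M"
  shows "x \<in> ell2"
proof -
  define q where "q = cmod l"
  define B where "B = (\<Sum>i. (cmod (G i))\<^sup>2)"
  have q: "0 \<le> q" "q < 1"
    using assms(1) by (auto simp: q_def)
  have GB: "(\<Sum>i<n. (cmod (G i))\<^sup>2) \<le> B" for n
    using assms(2) by (auto simp: ell2_def B_def intro!: sum_le_suminf)
  have step: "(cmod (x j))\<^sup>2 \<le> q * (cmod (x (Suc j)))\<^sup>2 + (cmod (G j))\<^sup>2 / (1 - q)" for j
  proof -
    have "cmod (x j) \<le> q * cmod (x (Suc j)) + cmod (G j)"
      unfolding q_def by (subst assms(3)) (metis norm_mult norm_triangle_ineq)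
    then have "(cmod (x j))\<^sup>2 \<le> (q * cmod (x (Suc j)) + cmod (G j))\<^sup>2"
      by (intro power_mono) auto
    with contraction_square_bound[OF q] show ?thesis
      by (meson order_trans)
  qed
  have "(\<Sum>i<n. (cmod (x i))\<^sup>2) \<le> (q * M\<^sup>2 + B / (1 - q)) / (1 - q)" for n
  proof -
    have "(\<Sum>i<n. (cmod (x (Suc i)))\<^sup>2) \<le> (\<Sum>i<Suc n. (cmod (x i))\<^sup>2)"
      unfolding sum.lessThan_Suc_shift[of _ n] by simp
    also have "\<dots> \<le> (\<Sum>i<n. (cmod (x i))\<^sup>2) + M\<^sup>2"
      using M[of n] by (simp add: power_mono)
    finally have shift: "(\<Sum>i<n. (cmod (x (Suc i)))\<^sup>2) \<le> (\<Sum>i<n. (cmod (x i))\<^sup>2) + M\<^sup>2" .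
    have "(\<Sum>i<n. (cmod (x i))\<^sup>2)
        \<le> (\<Sum>i<n. q * (cmod (x (Suc i)))\<^sup>2 + (cmod (G i))\<^sup>2 / (1 - q))"
      by (intro sum_mono step)
    also have "\<dots> = q * (\<Sum>i<n. (cmod (x (Suc i)))\<^sup>2) + (\<Sum>i<n. (cmod (G i))\<^sup>2) / (1 - q)"
      by (simp add: sum.distrib sum_distrib_left sum_divide_distrib)
    also have "\<dots> \<le> q * ((\<Sum>i<n. (cmod (x i))\<^sup>2) + M\<^sup>2) + B / (1 - q)"
      using GB q shift by (intro add_mono divide_right_mono mult_left_mono) auto
    finally have "(\<Sum>i<n. (cmod (x i))\<^sup>2) * (1 - q) \<le> q * M\<^sup>2 + B / (1 - q)"
      by (simp add: algebra_simps)
    then show ?thesis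
      using q by (simp add: pos_le_divide_eq)
  qed
  then show ?thesis
    unfolding ell2_iff_bounded_partial_sums by blast
qed

subsection \<open>Spectra of the CMV matrix\<close>

text \<open>The spectral analysis depends on the angles and on the wave number only through
  \<open>\<eta>\<close> and \<open>\<rho>\<close>, which are therefore abstract parameters
  here.\<close>

locale cmv_matrix =
  fixes A :: "nat \<Rightarrow> nat \<Rightarrow> complex" and \<eta> :: complex and \<rho> :: real
  assumes entries: "A i j =
     (if even i then (if j = i - 1 then cnj \<eta> else if j = i + 2 then complex_of_real \<rho> else 0)
      else (if j = i - 2 then complex_of_real \<rho> else if j = i + 1 then - \<eta> else 0))"
    and rho_nonneg: "\<rho> \<ge> 0"
    and rho_sq: "\<rho>\<^sup>2 = 1 - (cmod \<eta>)\<^sup>2"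
begin

text \<open>Truncated subtraction makes the formulas valid for \<open>j = 0\<close>, with \<open>u 0\<close> in the role of
  \<open>u (-1)\<close>.\<close>

lemma mat_op_even:
  fixes u :: "nat \<Rightarrow> complex"
  shows "mat_op A u (2 * j) = cnj \<eta> * u (2 * j - 1) + \<rho> * u (2 * j + 2)"
proof -
  have "mat_op A u (2 * j) = (\<Sum>m\<in>{2 * j - 1, 2 * j + 2}. A (2 * j) m * u m)"
    unfolding mat_op_def by (rule suminf_finite) (auto simp: entries)
  \<comment> \<open>The two columns are distinct also for \<open>j = 0\<close>, where they are 0 and
    2, so the sum over the doubleton has two separate terms.\<close>
  moreover have "2 * j + 2 \<noteq> 2 * j - 1"
    by simp
  ultimately show ?thesis
    by (simp add: entries)
qed

lemma mat_op_odd: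
  fixes u :: "nat \<Rightarrow> complex"
  shows "mat_op A u (Suc (2 * j)) = \<rho> * u (2 * j - 1) - \<eta> * u (2 * j + 2)"
proof -
  have "mat_op A u (Suc (2 * j)) = (\<Sum>m\<in>{2 * j - 1, 2 * j + 2}. A (Suc (2 * j)) m * u m)"
    unfolding mat_op_def by (rule suminf_finite) (auto simp: entries)
  moreover have "2 * j + 2 \<noteq> 2 * j - 1"
    by simp
  ultimately show ?thesis
    by (simp add: entries)
qed

lemma mat_op_zero: "mat_op A (\<lambda>_. 0) = (\<lambda>_. 0)"
  by (simp add: mat_op_def)

text \<open>Each pair of rows relates \<open>(u (2 j - 1), u (2 j))\<close> to
  \<open>(u (2 j + 1), u (2 j + 2))\<close>: this is the recurrence behind everything that
  follows.\<close>

lemma mat_op_eq_iff: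
  fixes u f :: "nat \<Rightarrow> complex"
  shows "(\<lambda>n. mat_op A u n - z * u n) = f \<longleftrightarrow>
    (\<forall>j. cnj \<eta> * u (2 * j - 1) + \<rho> * u (2 * j + 2) - z * u (2 * j) = f (2 * j)
      \<and> \<rho> * u (2 * j - 1) - \<eta> * u (2 * j + 2) - z * u (2 * j + 1) = f (2 * j + 1))"
  (is "?L \<longleftrightarrow> ?R")
proof
  assume ?L
  then show ?R
    by (auto simp: mat_op_even mat_op_odd)
next
  assume R: ?R
  show ?L
  proof
    fix n
    show "mat_op A u n - z * u n = f n"
      using R by (cases "even n") (auto elim!: evenE oddE simp: mat_op_even mat_op_odd)
  qed
qed

text \<open>Every row has at most two nonzero entries, so linearity holds for arbitrary sequences,
  with no convergence condition.\<close>

lemma mat_op_diff_scale: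
  "mat_op A (\<lambda>n. u n - c * w n) i = mat_op A u i - c * mat_op A w i"
  by (cases "even i")
    (auto elim!: evenE oddE simp: mat_op_even mat_op_odd, simp_all add: algebra_simps)

lemma mat_op_ell2:
  assumes "u \<in> ell2"
  shows "mat_op A u \<in> ell2"
proof (rule ell2_even_odd)
  have succ: "(\<lambda>j. u (2 * j + 2)) \<in> ell2"
    by (rule ell2_reindex[OF assms]) (simp add: inj_def)
  have "(\<lambda>j. u (Suc (2 * j))) \<in> ell2"
    by (rule ell2_reindex[OF assms]) (simp add: inj_def)
  \<comment> \<open>Square-summability ignores the first term; after a shift by one the truncated
    index \<open>2 j - 1\<close> becomes \<open>2 j + 1\<close>.\<close>
  then have pred: "(\<lambda>j. u (2 * j - 1)) \<in> ell2"
    unfolding ell2_def mem_Collect_eq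
    by (subst summable_Suc_iff[symmetric]) simp
  show "(\<lambda>j. mat_op A u (2 * j)) \<in> ell2"
    unfolding mat_op_even by (intro ell2_add ell2_scale succ pred)
  show "(\<lambda>j. mat_op A u (2 * j + 1)) \<in> ell2"
    unfolding Suc_eq_plus1[symmetric] mat_op_odd by (intro ell2_diff ell2_scale succ pred)
qed

lemma cont_subspace_subset: "cont_subspace A \<subseteq> ell2"
  by (auto simp: cont_subspace_def)

text \<open>An eigenvector in this subspace would be orthogonal to itself.\<close>

lemma cont_subspace_not_eigenvector: "u \<in> cont_subspace A \<Longrightarrow> \<not> eigenvector A z u"
  using ell2_inner_self_eq_0[of u] by (auto simp: cont_subspace_def eigenvector_def)

lemma eta_norm: "complex_of_real (\<rho>\<^sup>2) = 1 - \<eta> * cnj \<eta>"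
  unfolding rho_sq by (simp only: of_real_diff of_real_1 complex_norm_square)

text \<open>For \<open>\<rho> = 0\<close> the matrix splits into the block \<open>{0}\<close> and
  the two-dimensional blocks \<open>{2 j + 1, 2 j + 2}\<close>. Their eigenvectors leave only the
  zero vector in the orthogonal complement, and there every \<open>A - z\<close> is trivially
  bijective.\<close>

lemma cont_spectrum_empty:
  assumes "\<rho> = 0"
  shows "cont_spectrum A = {}"
proof -
  have eta1: "\<eta> * cnj \<eta> = 1"
    using eta_norm assms by simp
  have e0: "eigenvector A (cnj \<eta>) (\<lambda>n. if n = 0 then 1 else 0)"
    (is "eigenvector A _ ?e")
  proof -
    have "(\<lambda>n. mat_op A ?e n - cnj \<eta> * ?e n) = (\<lambda>_. 0)"
      unfolding mat_op_eq_iff using assms by auto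
    moreover have "?e \<in> ell2"
      unfolding ell2_def mem_Collect_eq by (rule summable_finite[of "{0}"]) auto
    moreover have "?e \<noteq> (\<lambda>_. 0)"
      by (auto simp: fun_eq_iff)
    ultimately show ?thesis
      by (auto simp: eigenvector_def fun_eq_iff)
  qed
  \<comment> \<open>On a two-dimensional block the matrix has rows \<open>(0, - \<eta>)\<close> and
    \<open>(cnj \<eta>, 0)\<close>; its eigenvalues are the square roots of -1, with eigenvector
    \<open>(z, cnj \<eta>)\<close>.\<close>
  have pair: "eigenvector A z (\<lambda>n. if n = Suc (2 * j) then z else if n = 2 * j + 2 then cnj \<eta> else 0)"
    (is "eigenvector A _ ?e") if "z\<^sup>2 = -1" for z j
  proof -
    have zz: "z * z = -1"
      using that by (simp add: power2_eq_square)
    have "(\<lambda>n. mat_op A ?e n - z * ?e n) = (\<lambda>_. 0)"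
      unfolding mat_op_eq_iff using assms eta1 zz
      by (auto simp: mult.commute) presburger+
    moreover have "?e \<in> ell2"
      unfolding ell2_def mem_Collect_eq by (rule summable_finite[of "{Suc (2 * j), 2 * j + 2}"]) auto
    moreover have "?e \<noteq> (\<lambda>_. 0)"
      using zz by (auto dest!: fun_cong[where x = "Suc (2 * j)"])
    ultimately show ?thesis
      by (auto simp: eigenvector_def fun_eq_iff)
  qed
  have "u = (\<lambda>_. 0)" if u: "u \<in> cont_subspace A" for u
  proof -
    have ortho: "ell2_inner v u = 0" if "eigenvector A z v" for z v
      using u that by (auto simp: cont_subspace_def)
    have inner_finite: "ell2_inner v u = (\<Sum>n\<in>N. cnj (v n) * u n)"
      if "finite N" and "\<And>n. n \<notin> N \<Longrightarrow> v n = 0" for v N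
      unfolding ell2_inner_def by (rule suminf_finite) (use that in auto)
    have u0: "u 0 = 0"
      using ortho[OF e0] by (subst (asm) inner_finite[of "{0}"]) auto
    have "u (Suc (2 * j)) = 0 \<and> u (2 * j + 2) = 0" for j
    proof -
      have eqn: "cnj z * u (Suc (2 * j)) + \<eta> * u (2 * j + 2) = 0" if "z\<^sup>2 = -1" for z
        using ortho[OF pair[OF that, of j]]
        by (subst (asm) inner_finite[of "{Suc (2 * j), 2 * j + 2}"]) auto
      have *: "- \<i> * u (Suc (2 * j)) + \<eta> * u (2 * j + 2) = 0" "\<i> * u (Suc (2 * j)) + \<eta> * u (2 * j + 2) = 0"
        using eqn[of \<i>] eqn[of "- \<i>"] by simp_all
      \<comment> \<open>Difference and sum of the equations for \<open>\<i>\<close> and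
        \<open>- \<i>\<close> isolate the two entries.\<close>
      have "2 * \<i> * u (Suc (2 * j)) = 0" "2 * \<eta> * u (2 * j + 2) = 0"
        using *(2) *(1) by (algebra)+
      moreover have "\<eta> \<noteq> 0"
        using eta1 by auto
      ultimately show ?thesis
        by simp
    qed
    then have "u (Suc n) = 0" for n
      by (cases "even n") (auto elim!: evenE oddE)
    with u0 show ?thesis
      by (metis not0_implies_Suc ext)
  qed
  moreover have "(\<lambda>_. 0) \<in> cont_subspace A"
    by (simp add: cont_subspace_def ell2_def ell2_inner_def)
  ultimately have "cont_subspace A = {\<lambda>_. 0}"
    by blast
  then show ?thesis
    by (auto simp: cont_spectrum_def bij_betw_def mat_op_zero)
qed

section \<open>Shape of the eigenvectors for positive \<open>\<rho>\<close>\<close>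

context
  assumes rho_pos: "\<rho> > 0"
begin

lemma Im_eta_less: "(Im \<eta>)\<^sup>2 < 1"
proof -
  have "0 < \<rho>\<^sup>2"
    using rho_pos by simp
  then show ?thesis
    unfolding rho_sq cmod_power2 by (smt (verit) zero_le_power2)
qed

text \<open>The quadratic equation says that \<open>(1, 1)\<close> is an eigenvector of the transfer matrix, with
  eigenvalue \<open>(z - cnj \<eta>) / \<rho>\<close>.\<close>

lemma transfer_root:
  assumes "z * (z + \<eta> - cnj \<eta>) = 1"
  shows "z = Complex (Re z) (- Im \<eta>)" and "(Re z)\<^sup>2 = 1 - (Im \<eta>)\<^sup>2"
proof -
  define p where "p = Im z + Im \<eta>"
  have re: "(Re z)\<^sup>2 - (Im z)\<^sup>2 - 2 * Im z * Im \<eta> = 1" and im: "Re z * p = 0"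
    using arg_cong[OF assms, of Re] arg_cong[OF assms, of Im]
    by (simp_all add: p_def algebra_simps power2_eq_square)
  have "p = 0"
  proof (rule ccontr)
    assume "p \<noteq> 0"
    then have "Re z = 0"
      using im by simp
    then have "p\<^sup>2 = (Im \<eta>)\<^sup>2 - 1"
      using re by (simp add: p_def power2_sum)
    then show False
      using Im_eta_less by (smt (verit) zero_le_power2)
  qed
  then have "Im z = - Im \<eta>"
    by (simp add: p_def)
  then show "z = Complex (Re z) (- Im \<eta>)" and "(Re z)\<^sup>2 = 1 - (Im \<eta>)\<^sup>2"
    using re by (simp_all add: complex_eq_iff power2_eq_square)
qed

lemma eigenvector_form:
  assumes "eigenvector A z u"
  obtains x c where "z = Complex x (- Im \<eta>)" and "x\<^sup>2 = 1 - (Im \<eta>)\<^sup>2" and "\<bar>x - Re \<eta>\<bar> < \<rho>"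
    and "c \<noteq> 0" and "u = (\<lambda>n. c * complex_of_real (((x - Re \<eta>) / \<rho>) ^ ((n + 1) div 2)))"
proof -
  define a b where "a j = u (2 * j - 1)" and "b j = u (2 * j)" for j
  have u: "u \<in> ell2" "u \<noteq> (\<lambda>_. 0)" "(\<lambda>n. mat_op A u n - z * u n) = (\<lambda>_. 0)"
    using assms by (auto simp: eigenvector_def)
  have eqs: "cnj \<eta> * a j + \<rho> * b (Suc j) = z * b j" "\<rho> * a j - \<eta> * b (Suc j) = z * a (Suc j)" for j
    using u(3) unfolding mat_op_eq_iff by (auto simp: a_def b_def)
  have a0: "a 0 = b 0"
    by (simp add: a_def b_def)
  have u_zero: "u = (\<lambda>_. 0)" if "\<And>j. a (Suc j) = 0" "\<And>j. b j = 0"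
  proof
    show "u n = 0" for n
      using that by (cases "even n") (auto elim!: evenE oddE simp: a_def b_def)
  qed
  have r: "complex_of_real \<rho> \<noteq> 0" "complex_of_real \<rho> * complex_of_real \<rho> = 1 - \<eta> * cnj \<eta>"
    using rho_pos eta_norm by (simp_all add: power2_eq_square)
  \<comment> \<open>For \<open>z = 0\<close> the two equations form a linear system in
    \<open>a j\<close> and \<open>b (Suc j)\<close> with determinant
    \<open>- (\<eta> * cnj \<eta> + \<rho>\<^sup>2) = - 1\<close>, so all entries vanish.\<close>
  have z: "z \<noteq> 0"
  proof
    assume "z = 0"
    then have *: "cnj \<eta> * a j + \<rho> * b (Suc j) = 0" "\<rho> * a j - \<eta> * b (Suc j) = 0" for j
      using eqs by simp_all
    have "a j = 0" "b (Suc j) = 0" for j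
      using *[of j] r(2) by algebra+
    then show False
      using u_zero u(2) a0 by (metis not0_implies_Suc)
  qed
  \<comment> \<open>This is the determinant of two consecutive vectors \<open>(a, b)\<close>; it is
    conserved because the transfer matrix has determinant 1.\<close>
  have const: "a j * b (Suc j) - a (Suc j) * b j = a 0 * b 1 - a 1 * b 0" for j
  proof (induction j)
    case (Suc j)
    have "\<rho> * z * (a (Suc j) * b (Suc (Suc j)) - a (Suc (Suc j)) * b (Suc j))
        = \<rho> * z * (a j * b (Suc j) - a (Suc j) * b j)"
      using eqs[of j] eqs[of "Suc j"] r(2) by algebra
    then show ?case
      using Suc r(1) z by simp
  qed simp
  have "(\<lambda>j. a j * b (Suc j) - a (Suc j) * b j) \<longlonglongrightarrow> 0 * 0 - 0 * 0"
  proof (intro tendsto_intros)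
    show b: "b \<longlonglongrightarrow> 0"
      unfolding b_def by (rule ell2_tendsto_0[OF ell2_reindex[OF u(1)]]) (simp add: inj_def)
    show sa: "(\<lambda>j. a (Suc j)) \<longlonglongrightarrow> 0"
      unfolding a_def by (rule ell2_tendsto_0[OF ell2_reindex[OF u(1)]]) (simp add: inj_def)
    show "(\<lambda>j. b (Suc j)) \<longlonglongrightarrow> 0"
      using b by (rule LIMSEQ_Suc)
    show "a \<longlonglongrightarrow> 0"
      using sa by (rule LIMSEQ_imp_Suc)
  qed
  then have "a 0 * b 1 = a 1 * b 0"
    unfolding const LIMSEQ_const_iff by simp
  then have det: "b 0 * (b 1 - a 1) = 0"
    using a0 by (simp add: algebra_simps)
  \<comment> \<open>Since \<open>a 0 = b 0\<close>, the recurrence determines the whole solution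
    from \<open>b 0\<close>, and a zero start yields the zero sequence.\<close>
  have b0: "b 0 \<noteq> 0"
  proof
    assume "b 0 = 0"
    then have "a j = 0 \<and> b j = 0" for j
    proof (induction j)
      case (Suc j)
      then have "b (Suc j) = 0"
        using eqs(1)[of j] r(1) by simp
      then show ?case
        using eqs(2)[of j] Suc z by simp
    qed (use a0 in simp)
    then show False
      using u_zero u(2) by blast
  qed
  with det have "a 1 = b 1"
    by simp
  then have *: "cnj \<eta> * b 0 + \<rho> * b 1 = z * b 0" "\<rho> * b 0 - \<eta> * b 1 = z * b 1"
    using eqs[of 0] a0 by simp_all
  \<comment> \<open>Eliminating \<open>b 1\<close> from the two equations leaves the quadratic
    equation of \<open>transfer_root\<close>.\<close>
  have "b 0 * (z * (z + \<eta> - cnj \<eta>) - 1) = 0"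
    using * r(2) by algebra
  then have root: "z * (z + \<eta> - cnj \<eta>) = 1"
    using b0 by simp
  note zx = transfer_root[OF root]
  define x where "x = Re z"
  define l where "l = (x - Re \<eta>) / \<rho>"
  have l: "z - cnj \<eta> = complex_of_real l * complex_of_real \<rho>"
    using zx rho_pos by (simp add: complex_eq_iff x_def l_def)
  have ab: "a j = b 0 * l ^ j \<and> b j = b 0 * l ^ j" for j
  proof (induction j)
    case (Suc j)
    then have "a j = b j" "b j = b 0 * l ^ j"
      by simp_all
    then have bs: "b (Suc j) = b j * l"
      using eqs(1)[of j] l r(1) by (simp add: algebra_simps)
    have "\<rho> * (z * a (Suc j) - z * b (Suc j)) = 0"
      using eqs(2)[of j] bs \<open>a j = b j\<close> l root r(2) by algebra
    then have "a (Suc j) = b (Suc j)"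
      using r(1) z by simp
    then show ?case
      using bs Suc by (simp add: mult.assoc mult.commute)
  qed (use a0 in simp)
  \<comment> \<open>Otherwise \<open>cmod (b j)\<close> never drops below \<open>cmod (b 0)\<close>,
    although \<open>b\<close> tends to 0.\<close>
  have "\<bar>l\<bar> < 1"
  proof (rule ccontr)
    assume "\<not> \<bar>l\<bar> < 1"
    then have "1 \<le> \<bar>l\<bar> ^ j" for j
      by (intro one_le_power) simp
    then have "cmod (b 0) * 1 \<le> cmod (b 0) * \<bar>l\<bar> ^ j" for j
      by (intro mult_left_mono) auto
    then have "cmod (b 0) \<le> cmod (b j)" for j
      using ab[of j] by (simp add: norm_mult norm_power)
    moreover have "(\<lambda>j. cmod (b j)) \<longlonglongrightarrow> 0"
      unfolding b_def tendsto_norm_zero_iff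
      by (rule ell2_tendsto_0[OF ell2_reindex[OF u(1)]]) (simp add: inj_def)
    ultimately have "cmod (b 0) \<le> 0"
      by (intro LIMSEQ_le_const) auto
    then show False
      using b0 by simp
  qed
  then have "\<bar>x - Re \<eta>\<bar> < \<rho>"
    using rho_pos by (simp add: l_def)
  moreover have "u = (\<lambda>n. b 0 * complex_of_real (((x - Re \<eta>) / \<rho>) ^ ((n + 1) div 2)))"
  proof
    fix n
    show "u n = b 0 * complex_of_real (((x - Re \<eta>) / \<rho>) ^ ((n + 1) div 2))"
      using ab[of "(n + 1) div 2"]
      by (cases "even n") (auto elim!: evenE oddE simp: l_def a_def b_def)
  qed
  ultimately show thesis
    using that[OF _ _ _ b0] zx by (metis x_def)
qed

end

end

section \<open>Forced recurrence at a candidate eigenvalue\<close>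

locale cmv_root = cmv_matrix +
  fixes x :: real
  assumes rho_pos: "\<rho> > 0" and x_sq: "x\<^sup>2 = 1 - (Im \<eta>)\<^sup>2"
begin

definition z :: complex where "z = Complex x (- Im \<eta>)"

text \<open>Eigenvalue of the transfer matrix on \<open>(1, 1)\<close>; it is real because the
  imaginary parts of \<open>z\<close> and \<open>cnj \<eta>\<close> agree. The other eigenvalue is
  \<open>m\<close>, the inverse of \<open>l\<close> by \<open>lm\<close>.\<close>

definition l :: real where "l = (x - Re \<eta>) / \<rho>"

definition m :: real where "m = (x + Re \<eta>) / \<rho>"

text \<open>The exponent gives positions \<open>2 j - 1\<close> and \<open>2 j\<close> the same
  value \<open>l ^ j\<close>: this is the solution that stays on the line
  \<open>a = b\<close>.\<close>

definition bound_state :: "nat \<Rightarrow> complex" where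
  "bound_state n = complex_of_real (l ^ ((n + 1) div 2))"

lemma rho_ne: "complex_of_real \<rho> \<noteq> 0"
  using rho_pos by simp

lemma l_eq: "complex_of_real l * complex_of_real \<rho> = z - cnj \<eta>"
  using rho_pos by (simp add: l_def z_def complex_eq_iff)

lemma m_eq: "complex_of_real m * complex_of_real \<rho> = z + \<eta>"
  using rho_pos by (simp add: m_def z_def complex_eq_iff)

lemma lm: "l * m = 1"
proof -
  have "x\<^sup>2 - (Re \<eta>)\<^sup>2 = \<rho>\<^sup>2"
    unfolding x_sq rho_sq cmod_power2 by simp
  then show ?thesis
    using rho_pos by (simp add: l_def m_def field_simps power2_eq_square)
qed

lemma lm_complex: "complex_of_real l * complex_of_real m = 1"
  using lm by (metis of_real_mult of_real_1)

lemma norm_z: "cmod z = 1"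
  by (simp add: z_def cmod_def x_sq)

lemma z_ne: "z \<noteq> 0"
  using norm_z by auto

text \<open>In the coordinates \<open>(b, a - b)\<close> the transfer matrix is triangular.\<close>

lemma recurrence_iff:
  fixes a b a' b' g h :: complex
  shows "cnj \<eta> * a + \<rho> * b' - z * b = g \<and> \<rho> * a - \<eta> * b' - z * a' = h \<longleftrightarrow>
    b' = l * b + (g - cnj \<eta> * (a - b)) / \<rho> \<and> a' - b' = m * (a - b) - (h + m * g) / z"
  (is "?E \<and> ?F \<longleftrightarrow> ?B \<and> ?D")
proof -
  have B: "?B \<longleftrightarrow> \<rho> * b' = z * b - cnj \<eta> * a + g"
  proof -
    have "?B \<longleftrightarrow> \<rho> * b' = \<rho> * (l * b) + (g - cnj \<eta> * (a - b))"
      using rho_ne by (auto simp: field_simps)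
    also have "\<rho> * (l * b) + (g - cnj \<eta> * (a - b)) = z * b - cnj \<eta> * a + g"
      using l_eq by algebra
    finally show ?thesis .
  qed
  then have EB: "?E \<longleftrightarrow> ?B"
    by (auto simp: algebra_simps)
  have D: "?D \<longleftrightarrow> z * (a' - b') = z * m * (a - b) - h - m * g"
    using z_ne by (simp add: field_simps)
  have "?F \<longleftrightarrow> ?D" if ?B
  proof -
    \<comment> \<open>Multiplying \<open>?B\<close> by \<open>m\<close> turns
      \<open>m * \<rho>\<close> into \<open>z + \<eta>\<close>, which supplies the term
      \<open>\<eta> * b'\<close> of \<open>?F\<close>.\<close>
    have "(z + \<eta>) * b' = m * (z * b - cnj \<eta> * a + g)"
      using that B m_eq by algebra
    moreover have "m * (z - cnj \<eta>) = \<rho>"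
      using l_eq lm_complex by algebra
    ultimately show ?thesis
      unfolding D by algebra
  qed
  with EB show ?thesis
    by blast
qed

lemma resolvent_iff:
  fixes u f :: "nat \<Rightarrow> complex"
  shows "(\<lambda>n. mat_op A u n - z * u n) = f \<longleftrightarrow>
    (\<forall>j. u (2 * j + 2) = l * u (2 * j) + (f (2 * j) - cnj \<eta> * (u (2 * j - 1) - u (2 * j))) / \<rho>
      \<and> u (2 * j + 1) - u (2 * j + 2)
        = m * (u (2 * j - 1) - u (2 * j)) - (f (2 * j + 1) + m * f (2 * j)) / z)"
  unfolding mat_op_eq_iff recurrence_iff ..

text \<open>The component \<open>a - b\<close> evolves on its own, with factor \<open>m\<close>. The
  indices are written so that this reads as a recurrence from \<open>j\<close> to
  \<open>Suc j\<close>.\<close>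

lemma resolvent_difference:
  fixes u f :: "nat \<Rightarrow> complex"
  assumes "(\<lambda>n. mat_op A u n - z * u n) = f"
  shows "u (2 * Suc j - 1) - u (2 * Suc j)
    = m * (u (2 * j - 1) - u (2 * j)) - (f (2 * j + 1) + m * f (2 * j)) / z"
proof -
  have "2 * Suc j - 1 = 2 * j + 1" and "2 * Suc j = 2 * j + 2"
    by simp_all
  then show ?thesis
    using assms unfolding resolvent_iff by metis
qed

lemma bound_state_ell2:
  assumes "\<bar>l\<bar> < 1"
  shows "bound_state \<in> ell2"
proof -
  have geo: "(\<lambda>j. complex_of_real (l ^ j)) \<in> ell2"
    by (rule ell2_forward_recurrence[where l = "complex_of_real l" and G = "\<lambda>_. 0"])
      (use assms in \<open>auto simp: ell2_def\<close>)
  show ?thesis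
  proof (rule ell2_even_odd)
    show "(\<lambda>j. bound_state (2 * j)) \<in> ell2"
      using geo by (simp add: bound_state_def)
    show "(\<lambda>j. bound_state (2 * j + 1)) \<in> ell2"
      using ell2_scale[OF geo, of l] by (simp add: bound_state_def)
  qed
qed

lemma bound_state_0: "bound_state 0 = 1"
  by (simp add: bound_state_def)

lemma bound_state_eq: "(\<lambda>n. mat_op A bound_state n - z * bound_state n) = (\<lambda>_. 0)"
proof -
  have "(2 * j - 1 + 1) div 2 = j" for j :: nat
    by (cases j) auto
  then show ?thesis
    unfolding resolvent_iff by (auto simp: bound_state_def)
qed

lemma eigenvector_bound_state:
  assumes "\<bar>l\<bar> < 1"
  shows "eigenvector A z bound_state"
proof -
  have "bound_state \<noteq> (\<lambda>_. 0)"
    using bound_state_0 by auto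
  then show ?thesis
    using bound_state_ell2[OF assms] fun_cong[OF bound_state_eq]
    by (auto simp: eigenvector_def)
qed

lemma z_in_point_spectrum_iff: "z \<in> point_spectrum A \<longleftrightarrow> \<bar>l\<bar> < 1"
proof
  assume "z \<in> point_spectrum A"
  then obtain u where "eigenvector A z u"
    by (auto simp: point_spectrum_def)
  then obtain y where "z = Complex y (- Im \<eta>)" and "\<bar>y - Re \<eta>\<bar> < \<rho>"
    using eigenvector_form[OF rho_pos] by metis
  then have "\<bar>x - Re \<eta>\<bar> < \<rho>"
    unfolding z_def by simp
  then show "\<bar>l\<bar> < 1"
    using rho_pos by (simp add: l_def)
next
  assume "\<bar>l\<bar> < 1"
  then show "z \<in> point_spectrum A"
    using eigenvector_bound_state by (auto simp: point_spectrum_def)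
qed

section \<open>Inverting the operator on the complement of the bound state\<close>

text \<open>Up to scalars the bound state is the only eigenvector: the other candidate has real part
  \<open>- x\<close>, and if both satisfied the decay condition, adding the squared inequalities
  would give \<open>(Re \<eta>)\<^sup>2 < 0\<close>.\<close>

lemma cont_subspace_eq:
  assumes "\<bar>l\<bar> < 1"
  shows "cont_subspace A = {u \<in> ell2. ell2_inner bound_state u = 0}"
proof -
  have "ell2_inner v u = 0"
    if u: "u \<in> ell2" "ell2_inner bound_state u = 0" and v: "eigenvector A w v" for u v w
  proof -
    obtain y c where y: "y\<^sup>2 = 1 - (Im \<eta>)\<^sup>2" "\<bar>y - Re \<eta>\<bar> < \<rho>"
      and vc: "v = (\<lambda>n. c * complex_of_real (((y - Re \<eta>) / \<rho>) ^ ((n + 1) div 2)))"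
      using eigenvector_form[OF rho_pos v] by metis
    have "y = x"
    proof (rule ccontr)
      assume "y \<noteq> x"
      then have yx: "y = - x"
        using y(1) x_sq by (metis power2_eq_iff)
      have "\<bar>x - Re \<eta>\<bar> < \<rho>"
        using assms rho_pos by (simp add: l_def)
      moreover have "t\<^sup>2 < \<rho>\<^sup>2" if "\<bar>t\<bar> < \<rho>" for t
        using power_strict_mono[OF that, of 2] by simp
      ultimately have "(x - Re \<eta>)\<^sup>2 < \<rho>\<^sup>2" and "(- x - Re \<eta>)\<^sup>2 < \<rho>\<^sup>2"
        using y(2) unfolding yx by blast+
      then have "(x - Re \<eta>)\<^sup>2 + (- x - Re \<eta>)\<^sup>2 < 2 * (x\<^sup>2 - (Re \<eta>)\<^sup>2)"
        unfolding rho_sq x_sq cmod_power2 by simp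
      then have "(Re \<eta>)\<^sup>2 < 0"
        by (simp add: power2_eq_square algebra_simps)
      then show False
        by (simp add: not_less[symmetric])
    qed
    then have "v = (\<lambda>n. c * bound_state n)"
      by (simp add: vc bound_state_def l_def)
    then show ?thesis
      using ell2_inner_scale_left[OF u(1) bound_state_ell2[OF assms]] u(2) by simp
  qed
  then show ?thesis
    using eigenvector_bound_state[OF assms] by (auto simp: cont_subspace_def)
qed

text \<open>The bound state is real, so the conjugation drops out, and its entries at
  \<open>2 j\<close> and \<open>2 j + 1\<close> are \<open>l ^ j\<close> and
  \<open>l ^ (j + 1)\<close>.\<close>

lemma inner_bound_state_sums:
  fixes f :: "nat \<Rightarrow> complex"
  assumes "\<bar>l\<bar> < 1" and "f \<in> ell2"
  shows "(\<lambda>j. complex_of_real l ^ j * (f (2 * j) + l * f (2 * j + 1))) sums ell2_inner bound_state f"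
  using ell2_inner_even_odd[OF assms(2) bound_state_ell2[OF assms(1)]]
  by (simp add: bound_state_def algebra_simps)

text \<open>Multiplied by \<open>l ^ n\<close>, the forced recurrence for \<open>a - b\<close> telescopes to the partial sums of
  the inner product of the right-hand side with the bound state.\<close>

lemma range_orthogonal:
  assumes l: "\<bar>l\<bar> < 1" and u: "u \<in> ell2"
  shows "ell2_inner bound_state (\<lambda>n. mat_op A u n - z * u n) = 0"
proof -
  define f where "f n = mat_op A u n - z * u n" for n
  define d where "d j = u (2 * j - 1) - u (2 * j)" for j
  have f: "f \<in> ell2"
    unfolding f_def by (intro ell2_diff mat_op_ell2 ell2_scale u)
  have rec: "d (Suc j) = m * d j - (f (2 * j + 1) + m * f (2 * j)) / z" for j
    unfolding d_def by (rule resolvent_difference) (simp add: f_def[abs_def])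
  have telescope: "(\<Sum>j<n. complex_of_real l ^ j * (f (2 * j) + l * f (2 * j + 1))) = - z * complex_of_real l ^ n * d n" for n
  proof (induction n)
    \<comment> \<open>Truncated subtraction makes \<open>d 0 = u 0 - u 0 = 0\<close>; this is where
      the boundary of the half-line enters.\<close>
    case 0
    show ?case
      by (simp add: d_def)
  next
    case (Suc n)
    have "z * d (Suc n) = z * m * d n - (f (2 * n + 1) + m * f (2 * n))"
      unfolding rec using z_ne by (simp add: field_simps)
    then have "f (2 * n) + l * f (2 * n + 1) - z * d n = - z * l * d (Suc n)"
      using lm_complex by algebra
    then have "complex_of_real l ^ n * (f (2 * n) + l * f (2 * n + 1) - z * d n)
        = complex_of_real l ^ n * (- z * l * d (Suc n))"
      by simp
    then show ?case
      unfolding sum.lessThan_Suc Suc by (simp add: right_diff_distrib distrib_left mult_ac)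
  qed
  have "(\<lambda>n. - z * complex_of_real l ^ n * d n) \<longlonglongrightarrow> - z * 0 * 0"
  proof (rule tendsto_mult[OF tendsto_mult[OF tendsto_const]])
    show "(\<lambda>n. complex_of_real l ^ n) \<longlonglongrightarrow> 0"
      using l by (intro LIMSEQ_power_zero) simp
    have "(\<lambda>j. u (Suc (2 * j)) - u (2 * j + 2)) \<longlonglongrightarrow> 0"
      by (rule ell2_tendsto_0[OF ell2_diff]; rule ell2_reindex[OF u]) (simp_all add: inj_def)
    then have "(\<lambda>j. d (Suc j)) \<longlonglongrightarrow> 0"
      by (simp add: d_def)
    then show "d \<longlonglongrightarrow> 0"
      by (rule LIMSEQ_imp_Suc)
  qed
  moreover have "(\<lambda>n. - z * complex_of_real l ^ n * d n) \<longlonglongrightarrow> ell2_inner bound_state f"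
    using inner_bound_state_sums[OF l f] unfolding sums_def telescope by simp
  ultimately show ?thesis
    using LIMSEQ_unique unfolding f_def[abs_def] by fastforce
qed

text \<open>The growing component \<open>d = a - b\<close> must be solved from infinity, as a
  convergent series. Its value at 0 is the inner product of \<open>f\<close> with the bound state,
  divided by \<open>z\<close>, so orthogonality is exactly the boundary condition
  \<open>d 0 = 0\<close>.\<close>

lemma resolvent_solution:
  fixes f :: "nat \<Rightarrow> complex"
  assumes l: "\<bar>l\<bar> < 1" and f: "f \<in> ell2" and ortho: "ell2_inner bound_state f = 0"
  obtains u where "u \<in> ell2" and "(\<lambda>n. mat_op A u n - z * u n) = f"
proof -
  \<comment> \<open>The forcing term of \<open>d\<close> once its recurrence is multiplied by
    \<open>l\<close> and solved for \<open>d j\<close>.\<close>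
  define p where "p j = (f (2 * j) + l * f (2 * j + 1)) / z" for j
  define d where "d n = (\<Sum>i. complex_of_real l ^ i * p (i + n))" for n
  \<comment> \<open>The starting value 0 is a free choice: another one adds a multiple of the bound
    state to the solution.\<close>
  define b where "b = rec_nat 0 (\<lambda>j y. complex_of_real l * y + (f (2 * j) - cnj \<eta> * d j) / \<rho>)"
  \<comment> \<open>Reassembles \<open>u (2 j) = b j\<close> and
    \<open>u (2 j - 1) = b j + d j\<close>; at \<open>j = 0\<close> these agree because
    \<open>d 0 = 0\<close>.\<close>
  define u where "u n = b ((n + 1) div 2) + (if even n then 0 else d ((n + 1) div 2))" for n
  have nl: "cmod (complex_of_real l) < 1"
    using l by simp
  have fe: "(\<lambda>j. f (2 * j)) \<in> ell2"
    by (rule ell2_reindex[OF f]) (simp add: inj_def)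
  have fo: "(\<lambda>j. f (2 * j + 1)) \<in> ell2"
    by (rule ell2_reindex[OF f]) (simp add: inj_def)
  have p: "p \<in> ell2"
    using ell2_scale[OF ell2_add[OF fe ell2_scale[OF fo]], of "1 / z" l]
    by (simp add: p_def[abs_def])
  obtain K where K: "cmod (p j) \<le> K" for j
    using Bseq_def[of p] convergent_imp_Bseq[OF convergentI[OF ell2_tendsto_0[OF p]]] by auto
  have geo: "(\<lambda>i. \<bar>l\<bar> ^ i * K) sums (1 / (1 - \<bar>l\<bar>) * K)"
    using l by (intro sums_mult2 geometric_sums) simp
  have term_bound: "norm (complex_of_real l ^ i * p (i + n)) \<le> \<bar>l\<bar> ^ i * K" for i n
    using K by (simp add: norm_mult norm_power mult_left_mono)
  have sum_d: "summable (\<lambda>i. complex_of_real l ^ i * p (i + n))" for n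
    by (rule summable_comparison_test'[where N = 0, OF sums_summable[OF geo] term_bound])
  have d_bound: "cmod (d n) \<le> 1 / (1 - \<bar>l\<bar>) * K" for n
    unfolding d_def sums_unique[OF geo] using term_bound sums_summable[OF geo]
    by (simp add: norm_suminf_le)
  have d_rec: "d n = l * d (Suc n) + p n" for n
  proof -
    have "d n = p n + (\<Sum>i. complex_of_real l ^ Suc i * p (Suc i + n))"
      unfolding d_def using suminf_split_head[OF sum_d[of n]] by (simp add: algebra_simps)
    also have "(\<Sum>i. complex_of_real l ^ Suc i * p (Suc i + n)) = l * d (Suc n)"
      unfolding d_def using suminf_mult[OF sum_d[of "Suc n"], of l] by (simp add: mult.assoc)
    finally show ?thesis
      by simp
  qed
  have d: "d \<in> ell2"
    by (rule ell2_backward_recurrence[OF nl p d_rec d_bound])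
  have d0: "d 0 = 0"
  proof -
    have "(\<lambda>i. complex_of_real l ^ i * p i) sums (ell2_inner bound_state f / z)"
      using sums_divide[OF inner_bound_state_sums[OF l f], of z] by (simp add: p_def)
    then show ?thesis
      using ortho by (simp add: d_def sums_iff)
  qed
  have b_rec: "b (Suc j) = l * b j + (f (2 * j) - cnj \<eta> * d j) / \<rho>" for j
    by (simp add: b_def)
  have b: "b \<in> ell2"
  proof (rule ell2_forward_recurrence[where G = "\<lambda>j. (f (2 * j) - cnj \<eta> * d j) / \<rho>", OF nl _ b_rec])
    show "(\<lambda>j. (f (2 * j) - cnj \<eta> * d j) / \<rho>) \<in> ell2"
      using ell2_scale[OF ell2_diff[OF fe ell2_scale[OF d]], of "1 / \<rho>" "cnj \<eta>"] by simp
  qed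
  have inj_Suc: "inj Suc"
    by simp
  have "u \<in> ell2"
    by (rule ell2_even_odd)
      (use b ell2_add[OF ell2_reindex[OF b inj_Suc] ell2_reindex[OF d inj_Suc]] in \<open>simp_all add: u_def\<close>)
  moreover have "(\<lambda>n. mat_op A u n - z * u n) = f"
  proof -
    have diff: "u (2 * j - 1) - u (2 * j) = d j" for j
      using d0 by (cases j) (simp_all add: u_def)
    have "m * d j = d (Suc j) + (f (2 * j + 1) + m * f (2 * j)) / z" for j
    proof -
      have "z * d j = z * l * d (Suc j) + (f (2 * j) + l * f (2 * j + 1))"
        unfolding d_rec[of j] p_def using z_ne by (simp add: field_simps)
      then have "z * (m * d j) = z * d (Suc j) + (f (2 * j + 1) + m * f (2 * j))"
        using lm_complex by algebra
      then show ?thesis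
        using z_ne by (simp add: field_simps)
    qed
    moreover have "u (2 * j) = b j" "u (2 * j + 1) = b (Suc j) + d (Suc j)" for j
      by (simp_all add: u_def)
    ultimately show ?thesis
      unfolding resolvent_iff diff using b_rec by (auto simp: u_def)
  qed
  ultimately show thesis
    by (rule that)
qed

text \<open>Injectivity: a difference with zero image would be an eigenvector in the complement.
  Surjectivity: a square-summable preimage is projected onto the complement by subtracting a
  multiple of the bound state, which \<open>A - z\<close> annihilates.\<close>

theorem bound_state_not_in_cont_spectrum:
  assumes l: "\<bar>l\<bar> < 1"
  shows "z \<notin> cont_spectrum A"
proof -
  let ?T = "\<lambda>u n. mat_op A u n - z * u n"
  note H = cont_subspace_eq[OF l]
  note v = bound_state_ell2[OF l]
  have "inj_on ?T (cont_subspace A)"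
  proof (rule inj_onI)
    fix u w
    assume uw: "u \<in> cont_subspace A" "w \<in> cont_subspace A" "?T u = ?T w"
    define y where "y = (\<lambda>n. u n - 1 * w n)"
    have "y \<in> cont_subspace A"
      using uw(1,2) ell2_inner_diff_scale_right[of u w bound_state 1] ell2_diff v
      unfolding H y_def by simp
    moreover have "mat_op A y = (\<lambda>n. z * y n)"
      using uw(3) unfolding y_def mat_op_diff_scale fun_eq_iff by (simp add: algebra_simps)
    ultimately have "y = (\<lambda>_. 0)"
      using cont_subspace_not_eigenvector[of y z] cont_subspace_subset
      by (auto simp: eigenvector_def)
    then show "u = w"
      by (simp add: y_def fun_eq_iff)
  qed
  moreover have "?T ` cont_subspace A = cont_subspace A"
  proof
    show "?T ` cont_subspace A \<subseteq> cont_subspace A"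
      unfolding H using range_orthogonal[OF l] by (auto intro!: ell2_diff mat_op_ell2 ell2_scale)
    show "cont_subspace A \<subseteq> ?T ` cont_subspace A"
    proof
      fix f
      assume "f \<in> cont_subspace A"
      then obtain u where u: "u \<in> ell2" "?T u = f"
        unfolding H using resolvent_solution[OF l] by auto
      define c where "c = ell2_inner bound_state u / ell2_inner bound_state bound_state"
      define y where "y = (\<lambda>n. u n - c * bound_state n)"
      have "ell2_inner bound_state bound_state \<noteq> 0"
        using ell2_inner_self_eq_0[OF v] bound_state_0 by auto
      then have "ell2_inner bound_state u - c * ell2_inner bound_state bound_state = 0"
        by (simp add: c_def)
      then have "y \<in> cont_subspace A"
        using ell2_inner_diff_scale_right[OF u(1) v v] ell2_diff[OF u(1) ell2_scale[OF v]]
        unfolding H y_def by simp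
      moreover have "?T y = f"
        using fun_cong[OF u(2)] fun_cong[OF bound_state_eq]
        unfolding y_def mat_op_diff_scale by (auto simp: algebra_simps)
      ultimately show "f \<in> ?T ` cont_subspace A"
        by blast
    qed
  qed
  ultimately show ?thesis
    by (simp add: cont_spectrum_def bij_betw_def)
qed

text \<open>The forcing by \<open>f\<close> starts \<open>a - b\<close> off at a nonzero value, which the recurrence then
  preserves in modulus.\<close>

theorem band_edge_in_cont_spectrum:
  assumes "Re \<eta> = 0"
  shows "z \<in> cont_spectrum A"
  unfolding cont_spectrum_def mem_Collect_eq
proof
  let ?T = "\<lambda>u n. mat_op A u n - z * u n"
  define f :: "nat \<Rightarrow> complex" where "f n = (if n = 0 then 1 else 0)" for n
  have "\<rho>\<^sup>2 = x\<^sup>2"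
    unfolding rho_sq x_sq cmod_power2 assms by simp
  then have x: "\<bar>x\<bar> = \<rho>"
    using rho_pos by (metis abs_of_pos power2_eq_iff abs_minus_cancel)
  then have m: "\<bar>m\<bar> = 1"
    using rho_pos assms by (simp add: m_def)
  \<comment> \<open>An eigenvector needs \<open>\<bar>y\<bar> < \<rho>\<close>, while both
    candidates have modulus \<open>\<rho>\<close>.\<close>
  have no_eigenvector: "\<not> eigenvector A w v" for w v
  proof
    assume "eigenvector A w v"
    then obtain y where "y\<^sup>2 = 1 - (Im \<eta>)\<^sup>2" "\<bar>y\<bar> < \<rho>"
      using eigenvector_form[OF rho_pos] assms by (metis diff_zero)
    then show False
      using x x_sq by (metis less_irrefl power2_eq_iff abs_minus_cancel)
  qed
  then have "cont_subspace A = ell2"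
    by (simp add: cont_subspace_def)
  moreover assume "bij_betw ?T (cont_subspace A) (cont_subspace A)"
  moreover have "f \<in> ell2"
    unfolding ell2_def mem_Collect_eq by (rule summable_finite[of "{0}"]) (auto simp: f_def)
  ultimately have "f \<in> ?T ` ell2"
    by (simp add: bij_betw_imp_surj_on)
  then obtain u where u: "u \<in> ell2" "?T u = f"
    by blast
  define d where "d j = u (2 * j - 1) - u (2 * j)" for j
  have rec: "d (Suc j) = m * d j - (f (2 * j + 1) + m * f (2 * j)) / z" for j
    unfolding d_def by (rule resolvent_difference[OF u(2)])
  have "cmod (d (Suc j)) = 1" for j
  proof (induction j)
    \<comment> \<open>As \<open>d 0 = 0\<close>, the unit impulse gives
      \<open>d 1 = - m / z\<close>, of modulus 1. Later steps are unforced and multiply by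
      \<open>m\<close>.\<close>
    case 0
    show ?case
      using rec[of 0] m norm_z by (simp add: d_def f_def norm_divide)
  next
    case (Suc j)
    then show ?case
      using rec[of "Suc j"] m by (simp add: f_def norm_mult)
  qed
  moreover have "(\<lambda>j. u (Suc (2 * j)) - u (2 * j + 2)) \<longlonglongrightarrow> 0"
    by (rule ell2_tendsto_0[OF ell2_diff]; rule ell2_reindex[OF u(1)]) (simp_all add: inj_def)
  then have "(\<lambda>j. cmod (d (Suc j))) \<longlonglongrightarrow> 0"
    by (intro tendsto_norm_zero) (simp add: d_def)
  ultimately show False
    by (simp add: LIMSEQ_const_iff)
qed

end

section \<open>Point spectrum and disjointness of the two spectra\<close>

context cmv_matrix
begin

lemma point_spectrum_eq:
  assumes "\<rho> > 0"
  shows "point_spectrum A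
    = {Complex x (- Im \<eta>) | x. x\<^sup>2 = 1 - (Im \<eta>)\<^sup>2 \<and> \<bar>x - Re \<eta>\<bar> < \<rho>}" (is "_ = ?S")
proof
  show "point_spectrum A \<subseteq> ?S"
    using eigenvector_form[OF assms] by (auto simp: point_spectrum_def) metis
  show "?S \<subseteq> point_spectrum A"
  proof
    fix w
    assume "w \<in> ?S"
    then obtain x where x: "w = Complex x (- Im \<eta>)" "x\<^sup>2 = 1 - (Im \<eta>)\<^sup>2" "\<bar>x - Re \<eta>\<bar> < \<rho>"
      by blast
    interpret cmv_root A \<eta> \<rho> x
      by standard (use assms x in auto)
    show "w \<in> point_spectrum A"
      using z_in_point_spectrum_iff x assms by (simp add: z_def l_def)
  qed
qed

lemma point_spectrum_disjoint_cont_spectrum: "point_spectrum A \<inter> cont_spectrum A = {}"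
proof (cases "\<rho> = 0")
  case True
  then show ?thesis
    using cont_spectrum_empty by simp
next
  case False
  then have pos: "\<rho> > 0"
    using rho_nonneg by simp
  have "w \<notin> cont_spectrum A" if w: "w \<in> point_spectrum A" for w
  proof -
    obtain x where x: "w = Complex x (- Im \<eta>)" "x\<^sup>2 = 1 - (Im \<eta>)\<^sup>2" "\<bar>x - Re \<eta>\<bar> < \<rho>"
      using w unfolding point_spectrum_eq[OF pos] by blast
    interpret cmv_root A \<eta> \<rho> x
      by standard (use pos x in auto)
    show ?thesis
      using bound_state_not_in_cont_spectrum x pos by (simp add: z_def l_def)
  qed
  then show ?thesis
    by blast
qed

end

text \<open>Squaring reduces the inequality to \<open>t * t < x * t\<close>. Since
  \<open>\<bar>t\<bar> < w = \<bar>x\<bar>\<close>, this says that \<open>x\<close> has the sign of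
  \<open>t\<close>. With \<open>t = Re \<eta>\<close> it decides which of the two candidates is an
  eigenvalue.\<close>

lemma abs_diff_less_iff_sgn:
  fixes w t p x :: real
  assumes "w > 0" and "p > 0" and "p\<^sup>2 = w\<^sup>2 - t\<^sup>2" and "x\<^sup>2 = w\<^sup>2"
  shows "\<bar>x - t\<bar> < p \<longleftrightarrow> t \<noteq> 0 \<and> x = sgn t * w"
proof -
  have "0 < p\<^sup>2"
    using assms(2) by simp
  then have "\<bar>t\<bar>\<^sup>2 < w\<^sup>2"
    unfolding assms(3) by simp
  then have t: "\<bar>t\<bar> < w"
    using assms(1) by (simp add: power2_less_imp_less)
  have "\<bar>x - t\<bar> < p \<longleftrightarrow> (x - t)\<^sup>2 < p\<^sup>2"
    using assms(2) abs_le_square_iff[of p "x - t"] by (simp add: not_le[symmetric])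
  also have "\<dots> \<longleftrightarrow> t * t < x * t"
    unfolding assms(3) power2_diff assms(4) by (auto simp: power2_eq_square)
  also have "\<dots> \<longleftrightarrow> t \<noteq> 0 \<and> x = sgn t * w"
    using assms(1,4) t by (auto simp: power2_eq_iff sgn_if mult_less_cancel_right abs_if split: if_splits)
  finally show ?thesis .
qed

subsection \<open>Dispersion relation\<close>

lemma abs_sin_mult_sin_le_1: "\<bar>sin a * sin b\<bar> \<le> (1 :: real)"
  using mult_mono[of "\<bar>sin a\<bar>" 1 "\<bar>sin b\<bar>" 1] by (simp add: abs_mult)

lemma norm_eta: "(cmod (eta \<alpha> \<beta> k))\<^sup>2 = (cos k * sin (\<alpha> + \<beta>))\<^sup>2 + (sin k * sin (\<alpha> - \<beta>))\<^sup>2"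
  by (simp add: eta_def cmod_power2)

lemma norm_eta_le_1: "(cmod (eta \<alpha> \<beta> k))\<^sup>2 \<le> 1"
proof -
  have "(cos k * sin (\<alpha> + \<beta>))\<^sup>2 + (sin k * sin (\<alpha> - \<beta>))\<^sup>2 \<le> (cos k)\<^sup>2 + (sin k)\<^sup>2"
    unfolding power_mult_distrib
    by (intro add_mono mult_left_le) (auto simp: abs_square_le_1)
  then show ?thesis
    by (simp add: norm_eta)
qed

lemma cmv_matrix_cmv: "cmv_matrix (cmv \<alpha> \<beta> k) (eta \<alpha> \<beta> k) (rho \<alpha> \<beta> k)"
  by standard (use norm_eta_le_1 in \<open>simp_all add: cmv_def rho_def\<close>)

lemma rho_pos: "cmod (eta \<alpha> \<beta> k) < 1 \<Longrightarrow> rho \<alpha> \<beta> k > 0"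
  by (simp add: rho_def abs_square_less_1)

text \<open>For \<open>\<sigma>\<close> equal to 1 or -1, the two points of the unit circle with
  imaginary part \<open>- Im \<eta>\<close>. Unlike \<open>theta0\<close>, each is continuous in
  \<open>k\<close>, so limits of \<open>theta0\<close> are read off from them.\<close>

definition edge :: "real \<Rightarrow> real \<Rightarrow> real \<Rightarrow> real \<Rightarrow> complex" where
  "edge \<alpha> \<beta> \<sigma> k =
    Complex (\<sigma> * sqrt (1 - (sin k * sin (\<alpha> - \<beta>))\<^sup>2)) (- (sin k * sin (\<alpha> - \<beta>)))"

lemma theta0_eq:
  "theta0 \<alpha> \<beta> k = (if cos k * sin (\<alpha> + \<beta>) \<le> 0 then - arcsin (sin k * sin (\<alpha> - \<beta>))
    else pi + arcsin (sin k * sin (\<alpha> - \<beta>)))"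
  using abs_sin_mult_sin_le_1[of k "\<alpha> - \<beta>"] by (auto simp: theta0_def arcsin_minus abs_le_iff)

lemma cis_theta0:
  "cis (theta0 \<alpha> \<beta> k) = edge \<alpha> \<beta> (if cos k * sin (\<alpha> + \<beta>) \<le> 0 then 1 else - 1) k"
  using abs_sin_mult_sin_le_1[of k "\<alpha> - \<beta>"]
  by (auto simp: theta0_eq edge_def complex_eq_iff cos_arcsin abs_le_iff cos_add sin_add)

lemma norm_edge: "\<bar>\<sigma>\<bar> = 1 \<Longrightarrow> cmod (edge \<alpha> \<beta> \<sigma> k) = 1"
proof -
  assume "\<bar>\<sigma>\<bar> = 1"
  then have "\<sigma>\<^sup>2 = 1"
    by (metis power2_abs one_power2)
  moreover have "(sin k * sin (\<alpha> - \<beta>))\<^sup>2 \<le> 1"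
    using abs_sin_mult_sin_le_1 by (simp add: abs_square_le_1)
  ultimately show ?thesis
    by (simp add: edge_def cmod_def power_mult_distrib)
qed

text \<open>The eigenvalue has the sign of
  \<open>Re \<eta> = - cos k * sin (\<alpha> + \<beta>)\<close> in its real part, which is the case
  distinction in \<open>theta0\<close>.\<close>

lemma point_spectrum_cmv:
  assumes "cmod (eta \<alpha> \<beta> k) < 1"
  shows "point_spectrum (cmv \<alpha> \<beta> k)
    = (if cos k * sin (\<alpha> + \<beta>) = 0 then {} else {cis (theta0 \<alpha> \<beta> k)})"
proof -
  interpret cmv_matrix "cmv \<alpha> \<beta> k" "eta \<alpha> \<beta> k" "rho \<alpha> \<beta> k"
    by (rule cmv_matrix_cmv)
  define t i where "t = - (cos k * sin (\<alpha> + \<beta>))" and "i = sin k * sin (\<alpha> - \<beta>)"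
  define w where "w = sqrt (1 - i\<^sup>2)"
  have eta: "Re (eta \<alpha> \<beta> k) = t" "Im (eta \<alpha> \<beta> k) = i"
    by (simp_all add: eta_def t_def i_def)
  have pos: "rho \<alpha> \<beta> k > 0"
    by (rule rho_pos[OF assms])
  have i: "i\<^sup>2 < 1"
    using Im_eta_less[OF pos] unfolding eta .
  then have w: "w > 0" "w\<^sup>2 = 1 - i\<^sup>2"
    by (simp_all add: w_def)
  have rho2: "(rho \<alpha> \<beta> k)\<^sup>2 = w\<^sup>2 - t\<^sup>2"
    unfolding rho_sq cmod_power2 eta w(2) by simp
  have "point_spectrum (cmv \<alpha> \<beta> k) = {Complex x (- i) | x. x\<^sup>2 = w\<^sup>2 \<and> \<bar>x - t\<bar> < rho \<alpha> \<beta> k}"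
    unfolding point_spectrum_eq[OF pos] eta w(2) ..
  also have "\<dots> = {Complex x (- i) | x. t \<noteq> 0 \<and> x = sgn t * w}"
  proof -
    have "x\<^sup>2 = w\<^sup>2 \<and> \<bar>x - t\<bar> < rho \<alpha> \<beta> k \<longleftrightarrow> t \<noteq> 0 \<and> x = sgn t * w" for x
      using abs_diff_less_iff_sgn[OF w(1) pos rho2, of x]
      by (auto simp: sgn_if power_mult_distrib)
    then show ?thesis
      by simp
  qed
  also have "\<dots> = (if cos k * sin (\<alpha> + \<beta>) = 0 then {} else {cis (theta0 \<alpha> \<beta> k)})"
    unfolding cis_theta0 edge_def i_def[symmetric] w_def[symmetric]
    by (auto simp: t_def sgn_if)
  finally show ?thesis .
qed

lemma sin_3pi_half: "sin (3 * pi / 2) = - 1"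
  using sin_3over2_pi by (simp add: mult.commute)

lemma cos_3pi_half: "cos (3 * pi / 2) = 0"
  using cos_3over2_pi by (simp add: mult.commute)

lemma cos_eq_0_iff_on_period:
  assumes "k \<in> {0..<2 * pi}"
  shows "cos k = 0 \<longleftrightarrow> k \<in> {pi / 2, 3 * pi / 2}"
proof
  assume "cos k = 0"
  then obtain i where i: "odd i" "k = of_int i * (pi / 2)"
    by (auto simp: cos_zero_iff_int)
  have "0 \<le> real_of_int i * (pi / 2)" "real_of_int i * (pi / 2) < 4 * (pi / 2)"
    using assms unfolding i(2) by simp_all
  then have "0 \<le> i" "i < 4"
    unfolding mult_less_cancel_right zero_le_mult_iff by auto
  then have "i = 1 \<or> i = 3"
    using i(1) by presburger
  then show "k \<in> {pi / 2, 3 * pi / 2}"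
    using i(2) by auto
next
  assume "k \<in> {pi / 2, 3 * pi / 2}"
  then show "cos k = 0"
    using cos_pi_half cos_3pi_half by (metis insertE singletonD)
qed

lemma Ed_iff: "(k, \<theta>) \<in> Ed \<alpha> \<beta> \<longleftrightarrow> k \<in> {0..<2 * pi} \<and> cis \<theta> \<in> point_spectrum (cmv \<alpha> \<beta> k)"
  by (auto simp: Ed_def)

lemma Bu_iff: "(k, \<theta>) \<in> Bu \<alpha> \<beta> \<longleftrightarrow> k \<in> {0..<2 * pi} \<and> cis \<theta> \<in> cont_spectrum (cmv \<alpha> \<beta> k)"
  by (auto simp: Bu_def)

lemma Ed_disjoint_Bu: "Ed \<alpha> \<beta> \<inter> Bu \<alpha> \<beta> = {}"
  using cmv_matrix.point_spectrum_disjoint_cont_spectrum[OF cmv_matrix_cmv]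
  by (fastforce simp: Ed_iff Bu_iff)

lemma Ed_iff_theta0:
  assumes "k \<in> {0..<2 * pi}" and "cmod (eta \<alpha> \<beta> k) < 1"
  shows "(k, \<theta>) \<in> Ed \<alpha> \<beta> \<longleftrightarrow>
    sin (\<alpha> + \<beta>) \<noteq> 0 \<and> k \<notin> {pi / 2, 3 * pi / 2} \<and> cis \<theta> = cis (theta0 \<alpha> \<beta> k)"
  using cos_eq_0_iff_on_period[OF assms(1)] assms(1)
  unfolding Ed_iff point_spectrum_cmv[OF assms(2)] by auto

text \<open>At these two wave numbers \<open>Re \<eta> = 0\<close>, so both candidates are band
  edges.\<close>

lemma edge_in_Bu:
  assumes "k \<in> {pi / 2, 3 * pi / 2}" and "cmod (eta \<alpha> \<beta> k) < 1"
    and "\<bar>\<sigma>\<bar> = 1" and "cis \<theta> = edge \<alpha> \<beta> \<sigma> k"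
  shows "(k, \<theta>) \<in> Bu \<alpha> \<beta>"
proof -
  have "pi / 2 \<in> {0..<2 * pi}" and "3 * pi / 2 \<in> {0..<2 * pi}"
    by simp_all
  then have k: "k \<in> {0..<2 * pi}"
    using assms(1) by (metis insertE singletonD)
  interpret cmv_matrix "cmv \<alpha> \<beta> k" "eta \<alpha> \<beta> k" "rho \<alpha> \<beta> k"
    by (rule cmv_matrix_cmv)
  have "\<sigma>\<^sup>2 = 1"
    using assms(3) by (metis power2_abs one_power2)
  moreover have "(sin k * sin (\<alpha> - \<beta>))\<^sup>2 \<le> 1"
    using abs_sin_mult_sin_le_1 by (simp add: abs_square_le_1)
  ultimately interpret cmv_root "cmv \<alpha> \<beta> k" "eta \<alpha> \<beta> k" "rho \<alpha> \<beta> k"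
      "\<sigma> * sqrt (1 - (sin k * sin (\<alpha> - \<beta>))\<^sup>2)"
    by unfold_locales (simp_all add: rho_pos[OF assms(2)] power_mult_distrib eta_def)
  have "z = edge \<alpha> \<beta> \<sigma> k"
    unfolding z_def edge_def by (simp add: eta_def)
  moreover have "z \<in> cont_spectrum (cmv \<alpha> \<beta> k)"
    by (rule band_edge_in_cont_spectrum) (use cos_eq_0_iff_on_period[OF k] assms(1) in \<open>simp add: eta_def\<close>)
  ultimately show ?thesis
    using k assms(4) by (simp add: Bu_iff)
qed

section \<open>Monotonicity on the two arcs\<close>

lemma cos_pos_first_arc: "k \<in> {- pi / 2<..<pi / 2} \<Longrightarrow> cos k > 0"
  by (simp add: cos_gt_zero_pi)

lemma cos_neg_second_arc: "k \<in> {pi / 2<..<3 * pi / 2} \<Longrightarrow> cos k < 0"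
  using cos_gt_zero_pi[of "k - pi"] by (simp add: cos_diff)

text \<open>Passing from one arc to the other reverses the monotonicity of \<open>sin\<close> and
  also switches between the branches \<open>pi + arcsin\<close> and \<open>- arcsin\<close>. The two
  reversals cancel, so one sign, that of
  \<open>sin (\<alpha> + \<beta>) * sin (\<alpha> - \<beta>)\<close>, governs both arcs.\<close>

lemma theta0_on_arc:
  assumes "sin (\<alpha> + \<beta>) \<noteq> 0" and "I \<in> arcs" and "x \<in> I" and "y \<in> I" and "x < y"
  shows "0 < sin (\<alpha> + \<beta>) * sin (\<alpha> - \<beta>) \<Longrightarrow> theta0 \<alpha> \<beta> x < theta0 \<alpha> \<beta> y"
    and "sin (\<alpha> + \<beta>) * sin (\<alpha> - \<beta>) < 0 \<Longrightarrow> theta0 \<alpha> \<beta> y < theta0 \<alpha> \<beta> x"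
    and "sin (\<alpha> - \<beta>) = 0 \<Longrightarrow> theta0 \<alpha> \<beta> x = theta0 \<alpha> \<beta> y"
proof -
  define s r where "s = sin (\<alpha> + \<beta>)" and "r = sin (\<alpha> - \<beta>)"
  have arcsin_mono: "arcsin (sin u * r) < arcsin (sin v * r)" if "sin u * r < sin v * r" for u v
    using that abs_sin_mult_sin_le_1[of _ "\<alpha> - \<beta>"] by (simp add: arcsin_less_mono r_def)
  have cases: "cos x > 0 \<and> cos y > 0 \<and> sin x < sin y \<or> cos x < 0 \<and> cos y < 0 \<and> sin y < sin x"
  proof (cases "I = {- pi / 2<..<pi / 2}")
    case True
    then show ?thesis
      using assms cos_pos_first_arc[of x] cos_pos_first_arc[of y] sin_monotone_2pi[of x y] by auto
  next
    case False
    then have I: "I = {pi / 2<..<3 * pi / 2}"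
      using assms by (auto simp: arcs_def)
    then have "sin (x - pi) < sin (y - pi)"
      using assms by (intro sin_monotone_2pi) auto
    then show ?thesis
      using assms I cos_neg_second_arc[of x] cos_neg_second_arc[of y] by (simp add: sin_diff)
  qed
  consider (pos) "cos x * s > 0" "cos y * s > 0" "0 < s * (sin y - sin x)"
    | (neg) "cos x * s < 0" "cos y * s < 0" "s * (sin y - sin x) < 0"
    using cases assms(1) unfolding s_def[symmetric]
    by (cases "s > 0") (auto simp: zero_less_mult_iff mult_less_0_iff)
  note branch = this
  \<comment> \<open>Transfers the sign of \<open>s * r\<close> to the increment of the argument of
    \<open>arcsin\<close>.\<close>
  have diff: "(s * (sin y - sin x)) * (s * r) = s\<^sup>2 * (sin y * r - sin x * r)"
    by (simp add: power2_eq_square algebra_simps)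
  have s2: "s\<^sup>2 > 0"
    using assms(1) by (simp add: s_def)
  show "theta0 \<alpha> \<beta> x < theta0 \<alpha> \<beta> y" if "0 < sin (\<alpha> + \<beta>) * sin (\<alpha> - \<beta>)"
  proof (cases rule: branch)
    case pos
    then have "0 < s\<^sup>2 * (sin y * r - sin x * r)"
      unfolding diff[symmetric] using that by (simp add: s_def r_def)
    then have "sin x * r < sin y * r"
      using s2 by (simp add: zero_less_mult_iff)
    then show ?thesis
      using arcsin_mono pos by (simp add: theta0_eq flip: s_def r_def)
  next
    case neg
    then have "s\<^sup>2 * (sin y * r - sin x * r) < 0"
      unfolding diff[symmetric] using that by (simp add: s_def r_def mult_neg_pos)
    then have "sin y * r < sin x * r"
      using s2 by (simp add: mult_less_0_iff)
    then show ?thesis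
      using arcsin_mono neg by (simp add: theta0_eq flip: s_def r_def)
  qed
  show "theta0 \<alpha> \<beta> y < theta0 \<alpha> \<beta> x" if "sin (\<alpha> + \<beta>) * sin (\<alpha> - \<beta>) < 0"
  proof (cases rule: branch)
    case pos
    then have "s\<^sup>2 * (sin y * r - sin x * r) < 0"
      unfolding diff[symmetric] using that by (simp add: s_def r_def mult_pos_neg)
    then have "sin y * r < sin x * r"
      using s2 by (simp add: mult_less_0_iff)
    then show ?thesis
      using arcsin_mono pos by (simp add: theta0_eq flip: s_def r_def)
  next
    case neg
    then have "0 < s\<^sup>2 * (sin y * r - sin x * r)"
      unfolding diff[symmetric] using that by (simp add: s_def r_def mult_neg_neg)
    then have "sin x * r < sin y * r"
      using s2 by (simp add: zero_less_mult_iff)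
    then show ?thesis
      using arcsin_mono neg by (simp add: theta0_eq flip: s_def r_def)
  qed
  show "theta0 \<alpha> \<beta> x = theta0 \<alpha> \<beta> y" if "sin (\<alpha> - \<beta>) = 0"
    by (cases rule: branch) (use that in \<open>simp_all add: theta0_eq flip: s_def\<close>)
qed

lemma increasing_theta0:
  assumes "0 < sin (\<alpha> + \<beta>) * sin (\<alpha> - \<beta>)"
  shows "increasing_on_circle (theta0 \<alpha> \<beta>)"
proof -
  have "sin (\<alpha> + \<beta>) \<noteq> 0"
    using assms by auto
  then show ?thesis
    unfolding increasing_on_circle_def monotone_on_def using theta0_on_arc(1) assms by blast
qed

lemma decreasing_theta0:
  assumes "sin (\<alpha> + \<beta>) * sin (\<alpha> - \<beta>) < 0"
  shows "decreasing_on_circle (theta0 \<alpha> \<beta>)"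
proof -
  have "sin (\<alpha> + \<beta>) \<noteq> 0"
    using assms by auto
  then show ?thesis
    unfolding decreasing_on_circle_def monotone_on_def using theta0_on_arc(2) assms by blast
qed

lemma constant_theta0:
  assumes "sin (\<alpha> + \<beta>) \<noteq> 0" and "sin (\<alpha> - \<beta>) = 0" and "I \<in> arcs"
  shows "theta0 \<alpha> \<beta> constant_on I"
proof -
  have "theta0 \<alpha> \<beta> x = theta0 \<alpha> \<beta> y" if "x \<in> I" "y \<in> I" for x y
    using theta0_on_arc(3)[OF assms(1,3)] that assms(2) by (metis linorder_neqE)
  then show ?thesis
    unfolding constant_on_def by blast
qed

lemma monotonic_theta0:
  assumes "sin (\<alpha> + \<beta>) \<noteq> 0"
  shows "monotonic_on_circle (theta0 \<alpha> \<beta>)"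
proof -
  consider "0 < sin (\<alpha> + \<beta>) * sin (\<alpha> - \<beta>)" | "sin (\<alpha> + \<beta>) * sin (\<alpha> - \<beta>) < 0" | "sin (\<alpha> - \<beta>) = 0"
    using assms by (metis linorder_neqE mult_eq_0_iff)
  then show ?thesis
  proof cases
    case 1
    then have "\<forall>I\<in>arcs. mono_on I (theta0 \<alpha> \<beta>)"
      using increasing_theta0 by (simp add: increasing_on_circle_def strict_mono_on_imp_mono_on)
    then show ?thesis
      by (simp add: monotonic_on_circle_def)
  next
    case 2
    have "antimono_on I (theta0 \<alpha> \<beta>)" if "I \<in> arcs" for I
      unfolding monotone_on_def
      using theta0_on_arc(2)[OF assms that _ _ _ 2] by (force simp: le_less)
    then show ?thesis
      by (simp add: monotonic_on_circle_def)
  next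
    case 3
    then have "\<forall>I\<in>arcs. mono_on I (theta0 \<alpha> \<beta>)"
      using constant_theta0[OF assms] by (fastforce simp: constant_on_def monotone_on_def)
    then show ?thesis
      by (simp add: monotonic_on_circle_def)
  qed
qed

section \<open>Continuity and one-sided limits\<close>

text \<open>Stated for the full neighbourhood filter, so that continuity and both one-sided limits
  follow by restriction.\<close>

lemma tendsto_edge: "(edge \<alpha> \<beta> \<sigma> \<longlongrightarrow> edge \<alpha> \<beta> \<sigma> k) (nhds k)"
  unfolding edge_def[abs_def] by (intro tendsto_Complex tendsto_intros filterlim_ident)

text \<open>The branch of \<open>theta0\<close> is locally constant away from the zeros of
  \<open>cos\<close>.\<close>

lemma eventually_sgn_cos:
  assumes "cos k * s \<noteq> (0 :: real)"
  shows "\<forall>\<^sub>F x in nhds k. cos x * s \<le> 0 \<longleftrightarrow> cos k * s \<le> 0"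
proof -
  have lim: "((\<lambda>x. cos x * s) \<longlongrightarrow> cos k * s) (nhds k)"
    by (intro tendsto_intros filterlim_ident)
  show ?thesis
  proof (cases "cos k * s < 0")
    case True
    then show ?thesis
      using order_tendstoD(2)[OF lim, of 0] by (auto elim: eventually_mono)
  next
    case False
    then have "0 < cos k * s"
      using assms by linarith
    then show ?thesis
      using order_tendstoD(1)[OF lim, of 0] by (auto elim: eventually_mono)
  qed
qed

lemma isCont_cis_theta0:
  assumes "cos k * sin (\<alpha> + \<beta>) \<noteq> 0"
  shows "isCont (\<lambda>x. cis (theta0 \<alpha> \<beta> x)) k"
proof -
  define \<sigma> :: real where "\<sigma> = (if cos k * sin (\<alpha> + \<beta>) \<le> 0 then 1 else - 1)"
  have ev: "\<forall>\<^sub>F x in nhds k. cis (theta0 \<alpha> \<beta> x) = edge \<alpha> \<beta> \<sigma> x"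
    using eventually_sgn_cos[OF assms] by (auto simp: cis_theta0 \<sigma>_def elim: eventually_mono)
  have "isCont (edge \<alpha> \<beta> \<sigma>) k"
    unfolding isCont_def by (rule tendsto_mono[OF at_within_le_nhds tendsto_edge])
  then show ?thesis
    by (simp add: isCont_cong[OF ev])
qed

lemma theta0_derivative_0:
  assumes "cos k * sin (\<alpha> + \<beta>) \<noteq> 0" and "sin (\<alpha> - \<beta>) = 0"
  shows "(theta0 \<alpha> \<beta> has_real_derivative 0) (at k)"
proof -
  have "\<forall>\<^sub>F x in nhds k. theta0 \<alpha> \<beta> x = theta0 \<alpha> \<beta> k"
    using eventually_sgn_cos[OF assms(1)] assms(2) by (auto simp: theta0_eq elim: eventually_mono)
  then have "(theta0 \<alpha> \<beta> has_real_derivative 0) (at k)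
      \<longleftrightarrow> ((\<lambda>_. theta0 \<alpha> \<beta> k) has_real_derivative 0) (at k)"
    by (intro DERIV_cong_ev) auto
  then show ?thesis
    by simp
qed

text \<open>\<open>\<sigma>\<close> is the sign of \<open>cos x * sin (\<alpha> + \<beta>)\<close>
  just before \<open>k\<close>; there \<open>theta0\<close> follows the branch
  \<open>- \<sigma>\<close> of \<open>edge\<close>, whose value at \<open>k\<close> is the
  limit.\<close>

lemma left_limit_theta0:
  assumes "b < k" and "\<And>x. x \<in> {b<..<k} \<Longrightarrow> 0 < \<sigma> * (cos x * sin (\<alpha> + \<beta>))"
    and "\<bar>\<sigma>\<bar> = 1" and "cis \<theta> = edge \<alpha> \<beta> (- \<sigma>) k"
  shows "left_limit (theta0 \<alpha> \<beta>) k \<theta>"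
proof -
  have "edge \<alpha> \<beta> (- \<sigma>) x = cis (theta0 \<alpha> \<beta> x)" if "x \<in> {b<..<k}" for x
    using assms(2)[OF that] assms(3) by (auto simp: cis_theta0 abs_if split: if_splits)
  then have "\<forall>\<^sub>F x in at_left k. edge \<alpha> \<beta> (- \<sigma>) x = cis (theta0 \<alpha> \<beta> x)"
    using eventually_at_left_real[OF assms(1)] by (auto elim: eventually_mono)
  moreover have "(edge \<alpha> \<beta> (- \<sigma>) \<longlongrightarrow> cis \<theta>) (at_left k)"
    unfolding assms(4) by (rule tendsto_mono[OF at_within_le_nhds tendsto_edge])
  ultimately show ?thesis
    unfolding left_limit_def by (rule Lim_transform_eventually[rotated])
qed

lemma right_limit_theta0:
  assumes "k < b" and "\<And>x. x \<in> {k<..<b} \<Longrightarrow> 0 < \<sigma> * (cos x * sin (\<alpha> + \<beta>))"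
    and "\<bar>\<sigma>\<bar> = 1" and "cis \<theta> = edge \<alpha> \<beta> (- \<sigma>) k"
  shows "right_limit (theta0 \<alpha> \<beta>) k \<theta>"
proof -
  have "edge \<alpha> \<beta> (- \<sigma>) x = cis (theta0 \<alpha> \<beta> x)" if "x \<in> {k<..<b}" for x
    using assms(2)[OF that] assms(3) by (auto simp: cis_theta0 abs_if split: if_splits)
  then have "\<forall>\<^sub>F x in at_right k. edge \<alpha> \<beta> (- \<sigma>) x = cis (theta0 \<alpha> \<beta> x)"
    using eventually_at_right_real[OF assms(1)] by (auto elim: eventually_mono)
  moreover have "(edge \<alpha> \<beta> (- \<sigma>) \<longlongrightarrow> cis \<theta>) (at_right k)"
    unfolding assms(4) by (rule tendsto_mono[OF at_within_le_nhds tendsto_edge])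
  ultimately show ?thesis
    unfolding right_limit_def by (rule Lim_transform_eventually[rotated])
qed

text \<open>\<open>cos\<close> changes sign at both points, so the branch of \<open>edge\<close>
  switches from \<open>- \<sigma>\<close> to \<open>\<sigma>\<close> at \<open>pi / 2\<close> and
  back at \<open>3 * pi / 2\<close>.\<close>

lemma theta0_limits:
  assumes "sin (\<alpha> + \<beta>) \<noteq> 0"
  defines "\<sigma> \<equiv> sgn (sin (\<alpha> + \<beta>))"
  shows "cis \<theta> = edge \<alpha> \<beta> (- \<sigma>) (pi / 2) \<Longrightarrow> left_limit (theta0 \<alpha> \<beta>) (pi / 2) \<theta>"
    and "cis \<theta> = edge \<alpha> \<beta> \<sigma> (pi / 2) \<Longrightarrow> right_limit (theta0 \<alpha> \<beta>) (pi / 2) \<theta>"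
    and "cis \<theta> = edge \<alpha> \<beta> \<sigma> (3 * pi / 2) \<Longrightarrow> left_limit (theta0 \<alpha> \<beta>) (3 * pi / 2) \<theta>"
    and "cis \<theta> = edge \<alpha> \<beta> (- \<sigma>) (3 * pi / 2) \<Longrightarrow> right_limit (theta0 \<alpha> \<beta>) (3 * pi / 2) \<theta>"
proof -
  have \<sigma>: "\<bar>\<sigma>\<bar> = 1" "\<bar>- \<sigma>\<bar> = 1"
    using assms by (simp_all add: sgn_if)
  have sgn: "\<sigma> * (c * sin (\<alpha> + \<beta>)) = c * \<bar>sin (\<alpha> + \<beta>)\<bar>" for c
    by (simp add: \<sigma>_def abs_sgn mult_ac)
  have pos: "0 < \<sigma> * (cos x * sin (\<alpha> + \<beta>))" if "cos x > 0" for x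
    unfolding sgn using that assms by simp
  have neg: "0 < - \<sigma> * (cos x * sin (\<alpha> + \<beta>))" if "cos x < 0" for x
    unfolding mult_minus_left sgn using that assms by (simp add: mult_less_0_iff)
  show "left_limit (theta0 \<alpha> \<beta>) (pi / 2) \<theta>" if "cis \<theta> = edge \<alpha> \<beta> (- \<sigma>) (pi / 2)"
    by (rule left_limit_theta0[OF _ _ \<sigma>(1) that, of "- pi / 2"]) (use pos cos_pos_first_arc in auto)
  show "right_limit (theta0 \<alpha> \<beta>) (pi / 2) \<theta>" if "cis \<theta> = edge \<alpha> \<beta> \<sigma> (pi / 2)"
    by (rule right_limit_theta0[where \<sigma> = "- \<sigma>" and b = "3 * pi / 2"])
      (use neg cos_neg_second_arc \<sigma> that in auto)
  show "left_limit (theta0 \<alpha> \<beta>) (3 * pi / 2) \<theta>" if "cis \<theta> = edge \<alpha> \<beta> \<sigma> (3 * pi / 2)"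
    by (rule left_limit_theta0[where \<sigma> = "- \<sigma>" and b = "pi / 2"])
      (use neg cos_neg_second_arc \<sigma> that in auto)
  have "cos x > 0" if "x \<in> {3 * pi / 2<..<2 * pi}" for x
    using cos_pos_first_arc[of "x - 2 * pi"] that by (simp add: cos_diff)
  then show "right_limit (theta0 \<alpha> \<beta>) (3 * pi / 2) \<theta>" if "cis \<theta> = edge \<alpha> \<beta> (- \<sigma>) (3 * pi / 2)"
    by (intro right_limit_theta0[where \<sigma> = \<sigma> and b = "2 * pi"]) (use pos \<sigma> that in auto)
qed

text \<open>The two limits are the two branches of \<open>edge\<close> at \<open>k\<close>. They
  differ because \<open>cmod (eta \<alpha> \<beta> k) < 1\<close> keeps their real parts away from
  0.\<close>

lemma theta0_jump:
  assumes "sin (\<alpha> + \<beta>) \<noteq> 0" and k: "k \<in> {pi / 2, 3 * pi / 2}" and eta: "cmod (eta \<alpha> \<beta> k) < 1"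
  shows "\<exists>a b. left_limit (theta0 \<alpha> \<beta>) k a \<and> right_limit (theta0 \<alpha> \<beta>) k b
    \<and> cis a \<noteq> cis b \<and> (k, a) \<in> Bu \<alpha> \<beta> \<and> (k, b) \<in> Bu \<alpha> \<beta>"
proof -
  obtain \<sigma> where \<sigma>: "\<bar>\<sigma>\<bar> = 1"
    and lim: "\<And>\<theta>. cis \<theta> = edge \<alpha> \<beta> \<sigma> k \<Longrightarrow> left_limit (theta0 \<alpha> \<beta>) k \<theta>"
      "\<And>\<theta>. cis \<theta> = edge \<alpha> \<beta> (- \<sigma>) k \<Longrightarrow> right_limit (theta0 \<alpha> \<beta>) k \<theta>"
  proof (cases "k = pi / 2")
    case True
    show thesis
      using that[of "- sgn (sin (\<alpha> + \<beta>))"] theta0_limits(1,2)[OF assms(1)] assms(1)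
      unfolding True by (simp add: abs_sgn_eq)
  next
    case False
    with k have k: "k = 3 * pi / 2"
      by blast
    show thesis
      using that[of "sgn (sin (\<alpha> + \<beta>))"] theta0_limits(3,4)[OF assms(1)] assms(1)
      unfolding k by (simp add: abs_sgn_eq)
  qed
  have arg: "\<exists>a. cis a = edge \<alpha> \<beta> \<tau> k" if "\<bar>\<tau>\<bar> = 1" for \<tau>
  proof -
    have "cmod (edge \<alpha> \<beta> \<tau> k) = 1"
      by (rule norm_edge[OF that])
    then have "cis (Arg (edge \<alpha> \<beta> \<tau> k)) = edge \<alpha> \<beta> \<tau> k"
      by (subst cis_Arg) (auto simp: sgn_eq)
    then show ?thesis ..
  qed
  obtain a b where ab: "cis a = edge \<alpha> \<beta> \<sigma> k" "cis b = edge \<alpha> \<beta> (- \<sigma>) k"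
    using arg[of \<sigma>] arg[of "- \<sigma>"] \<sigma> by auto
  have "(cmod (eta \<alpha> \<beta> k))\<^sup>2 < 1"
    using eta by (simp add: abs_square_less_1)
  then have "(sin k * sin (\<alpha> - \<beta>))\<^sup>2 < 1"
    unfolding norm_eta by (smt (verit) zero_le_power2)
  then have "edge \<alpha> \<beta> \<sigma> k \<noteq> edge \<alpha> \<beta> (- \<sigma>) k"
    using \<sigma> by (auto simp: edge_def)
  then have "cis a \<noteq> cis b"
    unfolding ab .
  moreover have "\<bar>- \<sigma>\<bar> = 1"
    using \<sigma> by simp
  ultimately show ?thesis
    using lim(1)[OF ab(1)] lim(2)[OF ab(2)]
      edge_in_Bu[OF k eta \<sigma> ab(1)] edge_in_Bu[OF k eta _ ab(2)] by blast
qed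

section \<open>Gap closings and jump endpoints\<close>

lemma theta_c_eq_0_iff: "theta_c \<alpha> \<beta> k = 0 \<longleftrightarrow> eta \<alpha> \<beta> k = 0"
proof -
  have "0 \<le> rho \<alpha> \<beta> k" "rho \<alpha> \<beta> k \<le> 1"
    using norm_eta_le_1 by (simp_all add: rho_def)
  then have "theta_c \<alpha> \<beta> k = 0 \<longleftrightarrow> rho \<alpha> \<beta> k = 1"
    unfolding theta_c_def by (metis arccos_1 cos_arccos cos_zero dual_order.trans le_minus_one_simps(1))
  also have "\<dots> \<longleftrightarrow> eta \<alpha> \<beta> k = 0"
    by (simp add: rho_def)
  finally show ?thesis .
qed

lemma theta_c_half_pi: "theta_c \<alpha> \<beta> (pi / 2) = arccos (sqrt (1 - (sin (\<alpha> - \<beta>))\<^sup>2))"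
  and theta_c_3half_pi: "theta_c \<alpha> \<beta> (3 * pi / 2) = arccos (sqrt (1 - (sin (\<alpha> - \<beta>))\<^sup>2))"
  by (simp_all add: theta_c_def rho_def norm_eta sin_3pi_half cos_3pi_half)

text \<open>Places the lower end of the first band on the circle; the other three band ends are its
  reflections in \<open>cis_reflections\<close>.\<close>

lemma cis_theta_c:
  assumes "k \<in> {pi / 2, 3 * pi / 2}"
  shows "cis (theta_c \<alpha> \<beta> k) = Complex (sqrt (1 - (sin (\<alpha> - \<beta>))\<^sup>2)) \<bar>sin (\<alpha> - \<beta>)\<bar>"
proof -
  have "(sin (\<alpha> - \<beta>))\<^sup>2 \<le> 1"
    by (simp add: abs_square_le_1)
  then have "0 \<le> sqrt (1 - (sin (\<alpha> - \<beta>))\<^sup>2)" "sqrt (1 - (sin (\<alpha> - \<beta>))\<^sup>2) \<le> 1"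
    "(sqrt (1 - (sin (\<alpha> - \<beta>))\<^sup>2))\<^sup>2 = 1 - (sin (\<alpha> - \<beta>))\<^sup>2"
    by simp_all
  moreover have "theta_c \<alpha> \<beta> k = arccos (sqrt (1 - (sin (\<alpha> - \<beta>))\<^sup>2))"
    using assms theta_c_half_pi theta_c_3half_pi by (metis insertE singletonD)
  ultimately show ?thesis
    using cos_arccos_abs[of "sqrt (1 - (sin (\<alpha> - \<beta>))\<^sup>2)"]
      sin_arccos_abs[of "sqrt (1 - (sin (\<alpha> - \<beta>))\<^sup>2)"]
    by (simp add: complex_eq_iff)
qed

lemma cis_reflections:
  "cis (pi + t) = - cis t" "cis (pi - t) = - cnj (cis t)" "cis (2 * pi - t) = cnj (cis t)"
  by (simp_all add: complex_eq_iff cos_add sin_add cos_diff sin_diff)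

text \<open>\<open>jumps_between\<close> is symmetric in its endpoints, so the sign of
  \<open>sin (\<alpha> + \<beta>)\<close>, which only decides which limit is the left one, need not
  match \<open>\<sigma>\<close>.\<close>

lemma jumps_theta0:
  assumes "sin (\<alpha> + \<beta>) \<noteq> 0" and "k \<in> {pi / 2, 3 * pi / 2}"
    and "cis a = edge \<alpha> \<beta> \<sigma> k" and "cis b = edge \<alpha> \<beta> (- \<sigma>) k" and "\<bar>\<sigma>\<bar> = 1"
  shows "jumps_between (theta0 \<alpha> \<beta>) k a b"
proof -
  have "\<sigma> = sgn (sin (\<alpha> + \<beta>)) \<or> \<sigma> = - sgn (sin (\<alpha> + \<beta>))"
    using assms(1,5) by (auto simp: sgn_if abs_if split: if_splits)
  then show ?thesis
    using assms(2-4) theta0_limits[OF assms(1)] unfolding jumps_between_def by fastforce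
qed

text \<open>The imaginary part of \<open>edge\<close> is
  \<open>- sin k * sin (\<alpha> - \<beta>)\<close>: negative at \<open>pi / 2\<close>, which
  selects the lower band ends, and positive at \<open>3 * pi / 2\<close>, which selects the upper
  ones. A negative \<open>sin (\<alpha> - \<beta>)\<close> exchanges the two.\<close>

lemma jumps_theta0_r_pos:
  assumes "sin (\<alpha> + \<beta>) \<noteq> 0" and "sin (\<alpha> - \<beta>) > 0"
  shows "jumps_between (theta0 \<alpha> \<beta>) (pi / 2)
      (pi + theta_c \<alpha> \<beta> (pi / 2)) (2 * pi - theta_c \<alpha> \<beta> (pi / 2))"
    and "jumps_between (theta0 \<alpha> \<beta>) (3 * pi / 2)
      (theta_c \<alpha> \<beta> (3 * pi / 2)) (pi - theta_c \<alpha> \<beta> (3 * pi / 2))"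
  by (rule jumps_theta0[OF assms(1), where \<sigma> = "- 1"];
      use assms(2) in \<open>simp add: cis_reflections cis_theta_c edge_def complex_eq_iff\<close>)
    (rule jumps_theta0[OF assms(1), where \<sigma> = 1];
      use assms(2) in \<open>simp add: cis_reflections cis_theta_c edge_def complex_eq_iff sin_3pi_half\<close>)

lemma jumps_theta0_r_neg:
  assumes "sin (\<alpha> + \<beta>) \<noteq> 0" and "sin (\<alpha> - \<beta>) < 0"
  shows "jumps_between (theta0 \<alpha> \<beta>) (pi / 2)
      (theta_c \<alpha> \<beta> (pi / 2)) (pi - theta_c \<alpha> \<beta> (pi / 2))"
    and "jumps_between (theta0 \<alpha> \<beta>) (3 * pi / 2)
      (pi + theta_c \<alpha> \<beta> (3 * pi / 2)) (2 * pi - theta_c \<alpha> \<beta> (3 * pi / 2))"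
  by (rule jumps_theta0[OF assms(1), where \<sigma> = 1];
      use assms(2) in \<open>simp add: cis_reflections cis_theta_c edge_def complex_eq_iff\<close>)
    (rule jumps_theta0[OF assms(1), where \<sigma> = "- 1"];
      use assms(2) in \<open>simp add: cis_reflections cis_theta_c edge_def complex_eq_iff sin_3pi_half\<close>)

text \<open>The condition \<open>cmod (eta \<alpha> \<beta> k) < 1\<close> sets apart the case
  \<open>\<rho> = 0\<close>. There the matrix is block diagonal, with eigenvalues
  \<open>\<i>\<close> and \<open>- \<i>\<close> among others and empty continuous spectrum, so
  \<open>theta0\<close> does not describe the eigenvalues and no limit point can lie in
  \<open>Bu\<close>.\<close>

theorem corollary2:
  fixes \<alpha> \<beta> s r :: real
  assumes "\<alpha> \<in> {0..<2 * pi}" and "\<beta> \<in> {0..<2 * pi}"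
    and "s = sin (\<alpha> + \<beta>)" and "r = sin (\<alpha> - \<beta>)"
  shows
    "Ed \<alpha> \<beta> \<inter> Bu \<alpha> \<beta> = {}
   \<and> (\<forall>k\<in>{0..<2 * pi}. cmod (eta \<alpha> \<beta> k) < 1 \<longrightarrow>
        (\<forall>\<theta>. (k, \<theta>) \<in> Ed \<alpha> \<beta> \<longleftrightarrow>
           s \<noteq> 0 \<and> k \<notin> {pi / 2, 3 * pi / 2} \<and> cis \<theta> = cis (theta0 \<alpha> \<beta> k)))
   \<and> (s \<noteq> 0 \<longrightarrow>
        monotonic_on_circle (theta0 \<alpha> \<beta>)
      \<and> (\<forall>k\<in>{0..<2 * pi} - {pi / 2, 3 * pi / 2}. isCont (\<lambda>x. cis (theta0 \<alpha> \<beta> x)) k)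
      \<and> (\<forall>k\<in>{pi / 2, 3 * pi / 2}. cmod (eta \<alpha> \<beta> k) < 1 \<longrightarrow>
           (\<exists>a b. left_limit (theta0 \<alpha> \<beta>) k a \<and> right_limit (theta0 \<alpha> \<beta>) k b
                \<and> cis a \<noteq> cis b \<and> (k, a) \<in> Bu \<alpha> \<beta> \<and> (k, b) \<in> Bu \<alpha> \<beta>)))
   \<and> ((theta_c \<alpha> \<beta> 0 = 0 \<longleftrightarrow> sgn s = 0) \<and> (theta_c \<alpha> \<beta> pi = 0 \<longleftrightarrow> sgn s = 0)
      \<and> (sgn s = 0 \<longrightarrow>
           (\<forall>k\<in>{0..<2 * pi}. cmod (eta \<alpha> \<beta> k) < 1 \<longrightarrow> (\<forall>\<theta>. (k, \<theta>) \<notin> Ed \<alpha> \<beta>))))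
   \<and> ((sgn s, sgn r) = (1, 1) \<longrightarrow>
        increasing_on_circle (theta0 \<alpha> \<beta>)
      \<and> jumps_between (theta0 \<alpha> \<beta>) (pi / 2)
          (pi + theta_c \<alpha> \<beta> (pi / 2)) (2 * pi - theta_c \<alpha> \<beta> (pi / 2))
      \<and> jumps_between (theta0 \<alpha> \<beta>) (3 * pi / 2)
          (theta_c \<alpha> \<beta> (3 * pi / 2)) (pi - theta_c \<alpha> \<beta> (3 * pi / 2)))
   \<and> ((sgn s, sgn r) = (1, -1) \<longrightarrow>
        decreasing_on_circle (theta0 \<alpha> \<beta>)
      \<and> jumps_between (theta0 \<alpha> \<beta>) (pi / 2)
          (theta_c \<alpha> \<beta> (pi / 2)) (pi - theta_c \<alpha> \<beta> (pi / 2))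
      \<and> jumps_between (theta0 \<alpha> \<beta>) (3 * pi / 2)
          (pi + theta_c \<alpha> \<beta> (3 * pi / 2)) (2 * pi - theta_c \<alpha> \<beta> (3 * pi / 2)))
   \<and> ((sgn s, sgn r) = (-1, 1) \<longrightarrow>
        decreasing_on_circle (theta0 \<alpha> \<beta>)
      \<and> jumps_between (theta0 \<alpha> \<beta>) (pi / 2)
          (pi + theta_c \<alpha> \<beta> (pi / 2)) (2 * pi - theta_c \<alpha> \<beta> (pi / 2))
      \<and> jumps_between (theta0 \<alpha> \<beta>) (3 * pi / 2)
          (theta_c \<alpha> \<beta> (3 * pi / 2)) (pi - theta_c \<alpha> \<beta> (3 * pi / 2)))
   \<and> ((sgn s, sgn r) = (-1, -1) \<longrightarrow>
        increasing_on_circle (theta0 \<alpha> \<beta>)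
      \<and> jumps_between (theta0 \<alpha> \<beta>) (pi / 2)
          (theta_c \<alpha> \<beta> (pi / 2)) (pi - theta_c \<alpha> \<beta> (pi / 2))
      \<and> jumps_between (theta0 \<alpha> \<beta>) (3 * pi / 2)
          (pi + theta_c \<alpha> \<beta> (3 * pi / 2)) (2 * pi - theta_c \<alpha> \<beta> (3 * pi / 2)))
   \<and> ((theta_c \<alpha> \<beta> (pi / 2) = 0 \<longleftrightarrow> sgn r = 0) \<and> (theta_c \<alpha> \<beta> (3 * pi / 2) = 0 \<longleftrightarrow> sgn r = 0)
      \<and> (sgn s \<noteq> 0 \<and> sgn r = 0 \<longrightarrow>
           (\<forall>k\<in>{0..<2 * pi} - {pi / 2, 3 * pi / 2}.
              (theta0 \<alpha> \<beta> has_real_derivative 0) (at k))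
         \<and> (\<forall>I\<in>arcs. theta0 \<alpha> \<beta> constant_on I)))"
proof -
  have eta_values: "eta \<alpha> \<beta> 0 = Complex (- s) 0" "eta \<alpha> \<beta> pi = Complex s 0"
    "eta \<alpha> \<beta> (pi / 2) = Complex 0 r" "eta \<alpha> \<beta> (3 * pi / 2) = Complex 0 (- r)"
    by (simp_all add: eta_def assms(3,4) sin_3pi_half cos_3pi_half)
  have cos_s: "cos k * s \<noteq> 0" if "k \<in> {0..<2 * pi} - {pi / 2, 3 * pi / 2}" and "s \<noteq> 0" for k
    using that cos_eq_0_iff_on_period by (metis DiffD1 DiffD2 mult_eq_0_iff)
  have sgn: "sgn s = 0 \<longleftrightarrow> s = 0" "sgn r = 0 \<longleftrightarrow> r = 0"
    "sgn s = 1 \<longleftrightarrow> s > 0" "sgn r = 1 \<longleftrightarrow> r > 0" "sgn s = -1 \<longleftrightarrow> s < 0" "sgn r = -1 \<longleftrightarrow> r < 0"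
    by (simp_all add: sgn_if)
  have Ed: "\<forall>k\<in>{0..<2 * pi}. cmod (eta \<alpha> \<beta> k) < 1 \<longrightarrow> (\<forall>\<theta>. (k, \<theta>) \<in> Ed \<alpha> \<beta> \<longleftrightarrow>
      s \<noteq> 0 \<and> k \<notin> {pi / 2, 3 * pi / 2} \<and> cis \<theta> = cis (theta0 \<alpha> \<beta> k))"
    using Ed_iff_theta0 unfolding assms(3) by blast
  have circle: "s \<noteq> 0 \<longrightarrow> monotonic_on_circle (theta0 \<alpha> \<beta>)
      \<and> (\<forall>k\<in>{0..<2 * pi} - {pi / 2, 3 * pi / 2}. isCont (\<lambda>x. cis (theta0 \<alpha> \<beta> x)) k)
      \<and> (\<forall>k\<in>{pi / 2, 3 * pi / 2}. cmod (eta \<alpha> \<beta> k) < 1 \<longrightarrow>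
           (\<exists>a b. left_limit (theta0 \<alpha> \<beta>) k a \<and> right_limit (theta0 \<alpha> \<beta>) k b
                \<and> cis a \<noteq> cis b \<and> (k, a) \<in> Bu \<alpha> \<beta> \<and> (k, b) \<in> Bu \<alpha> \<beta>))"
    using monotonic_theta0 isCont_cis_theta0 cos_s theta0_jump unfolding assms(3) by blast
  have flat: "sgn s \<noteq> 0 \<and> sgn r = 0 \<longrightarrow>
      (\<forall>k\<in>{0..<2 * pi} - {pi / 2, 3 * pi / 2}. (theta0 \<alpha> \<beta> has_real_derivative 0) (at k))
      \<and> (\<forall>I\<in>arcs. theta0 \<alpha> \<beta> constant_on I)"
    using theta0_derivative_0 constant_theta0 cos_s unfolding sgn unfolding assms(3,4) by blast
  have gaps: "theta_c \<alpha> \<beta> 0 = 0 \<longleftrightarrow> sgn s = 0" "theta_c \<alpha> \<beta> pi = 0 \<longleftrightarrow> sgn s = 0"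
    "theta_c \<alpha> \<beta> (pi / 2) = 0 \<longleftrightarrow> sgn r = 0" "theta_c \<alpha> \<beta> (3 * pi / 2) = 0 \<longleftrightarrow> sgn r = 0"
    unfolding theta_c_eq_0_iff eta_values sgn by (auto simp: complex_eq_iff)
  have increasing: "increasing_on_circle (theta0 \<alpha> \<beta>)" if "0 < s * r"
    using increasing_theta0 that by (simp add: assms(3,4))
  have decreasing: "decreasing_on_circle (theta0 \<alpha> \<beta>)" if "s * r < 0"
    using decreasing_theta0 that by (simp add: assms(3,4))
  note jumps_pos = jumps_theta0_r_pos[of \<alpha> \<beta>, folded assms(3,4)]
  note jumps_neg = jumps_theta0_r_neg[of \<alpha> \<beta>, folded assms(3,4)]
  have sign_pp: "(sgn s, sgn r) = (1, 1) \<Longrightarrow> 0 < s * r \<and> s \<noteq> 0 \<and> r > 0"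
    and sign_pm: "(sgn s, sgn r) = (1, -1) \<Longrightarrow> s * r < 0 \<and> s \<noteq> 0 \<and> r < 0"
    and sign_mp: "(sgn s, sgn r) = (-1, 1) \<Longrightarrow> s * r < 0 \<and> s \<noteq> 0 \<and> r > 0"
    and sign_mm: "(sgn s, sgn r) = (-1, -1) \<Longrightarrow> 0 < s * r \<and> s \<noteq> 0 \<and> r < 0"
    by (auto simp: sgn mult_pos_neg mult_neg_pos mult_neg_neg)
  show ?thesis
    apply (intro conjI)
    subgoal by (rule Ed_disjoint_Bu)
    subgoal by (rule Ed)
    subgoal by (rule circle)
    subgoal by (rule gaps)
    subgoal by (rule gaps)
    subgoal using Ed sgn by blast
    subgoal using increasing jumps_pos sign_pp by blast
    subgoal using decreasing jumps_neg sign_pm by blast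
    subgoal using decreasing jumps_pos sign_mp by blast
    subgoal using increasing jumps_neg sign_mm by blast
    subgoal by (rule gaps)
    subgoal by (rule gaps)
    subgoal by (rule flat)
    done
qed

end
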